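(* Let $G = G_0 = (V,E)$ be a graph on $n$ vertices and let $k$ be a positive integer. For each $i \in \{1,\dots,k\}$ let $G_i$ be obtained from $G_{i-1}$ by deleting the set $S_i \subseteq V(G_{i-1})$ consisting of all vertices $v \in V(G_{i-1})$ that satisfy a property which can be decided, given (oracle) access to $G_{i-1}$, using $O(\log n)$ bits of space. Write $V_i = V(G_i)$ and $E_i = E(G_i)$. Then, given read-only access to $G$, for each $i \in \{1,\dots,k\}$ one can enumerate, and answer membership queries for, each of $S_i$, $V_i$ and $E_i$ in time $n^{O(i)}$ using $O(i \log n)$ bits of space.
   Context: Model of computation: word RAM with words of $O(\log n)$ bits; the input is given in a canonical encoding and is read-only; output is written to a write-only stream that cannot be read back; space is measured as the number of bits of auxiliary read-write memory used. "Enumerate" means producing the elements one after another (e.g. as an output stream or to be consumed by another procedure). *)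

theory Defs
  imports Complex_Main
begin

record graph =
  verts :: "nat set"
  edges :: "nat set set"

definition simple_graph_on :: "nat \<Rightarrow> graph \<Rightarrow> bool" where
  "simple_graph_on n G \<longleftrightarrow>
     verts G = {..<n} \<and> (\<forall>e\<in>edges G. e \<subseteq> verts G \<and> card e = 2)"

definition delete_verts :: "graph \<Rightarrow> nat set \<Rightarrow> graph" where
  "delete_verts G S = \<lparr>verts = verts G - S, edges = {e \<in> edges G. e \<inter> S = {}}\<rparr>"

text \<open>The predicate \<open>P i H v\<close> says that the vertex \<open>v\<close> of \<open>H\<close> has the property used in round \<open>i\<close>;
  rounds are counted from 1, and \<open>layer P G i\<close> is the graph $G_i$.\<close>

primrec layer :: "(nat \<Rightarrow> graph \<Rightarrow> nat \<Rightarrow> bool) \<Rightarrow> graph \<Rightarrow> nat \<Rightarrow> graph" where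
  "layer P G 0 = G"
| "layer P G (Suc i) =
     delete_verts (layer P G i) {v \<in> verts (layer P G i). P (Suc i) (layer P G i) v}"

definition deleted :: "(nat \<Rightarrow> graph \<Rightarrow> nat \<Rightarrow> bool) \<Rightarrow> graph \<Rightarrow> nat \<Rightarrow> nat set" where
  "deleted P G i = {v \<in> verts (layer P G (i - 1)). P i (layer P G (i - 1)) v}"

text \<open>A word RAM. Words are natural numbers below \<open>2 ^ w\<close>. The auxiliary memory is an array of words,
  initially 0; operands of instructions are addresses in it (there are no further registers).
  The read-only input consists of a list of argument words and a graph \<open>H\<close> whose vertices are
  numbers below \<open>n\<close>; it can be accessed only through the instructions
  \<open>Arg\<close>, \<open>NumV\<close> (which reads \<open>n\<close>), \<open>IsVert\<close> and \<open>IsEdge\<close>.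
  If \<open>H\<close> is the input graph on \<open>{..<n}\<close>, this is random access to its adjacency matrix;
  in general it is oracle access to a graph on a subset of \<open>{..<n}\<close>.\<close>

datatype binop = Add | Sub | Mul | Div | Mod | BitAnd | BitOr | BitXor | Shl | Shr

datatype instr =
    Const nat nat
  | Copy nat nat
  | Op binop nat nat nat
  | Load nat nat
  | Store nat nat
  | Arg nat nat
  | NumV nat
  | IsVert nat nat
  | IsEdge nat nat nat
  | Output nat
  | Jump nat
  | JumpZero nat nat
  | JumpLess nat nat nat
  | Halt

type_synonym program = "instr list"

fun binop_val :: "nat \<Rightarrow> binop \<Rightarrow> nat \<Rightarrow> nat \<Rightarrow> nat" where
  "binop_val w Add x y = (x + y) mod 2 ^ w"
| "binop_val w Sub x y = nat ((int x - int y) mod 2 ^ w)"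
| "binop_val w Mul x y = (x * y) mod 2 ^ w"
| "binop_val w Div x y = x div y"
| "binop_val w Mod x y = x mod y"
| "binop_val w BitAnd x y = Bit_Operations.and x y"
| "binop_val w BitOr x y = Bit_Operations.or x y"
| "binop_val w BitXor x y = Bit_Operations.xor x y"
| "binop_val w Shl x y = push_bit y x mod 2 ^ w"
| "binop_val w Shr x y = drop_bit y x"

record config =
  pc :: nat
  mem :: "nat \<Rightarrow> nat"
  out :: "nat list"

definition init_config :: config where
  "init_config = \<lparr>pc = 0, mem = (\<lambda>_. 0), out = []\<rparr>"

definition halted :: "program \<Rightarrow> config \<Rightarrow> bool" where
  "halted p s \<longleftrightarrow> pc s \<ge> length p \<or> p ! pc s = Halt"

definition set_cell :: "nat \<Rightarrow> nat \<Rightarrow> config \<Rightarrow> config" where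
  "set_cell a x s = s\<lparr>pc := pc s + 1, mem := (mem s)(a := x)\<rparr>"

fun exec :: "nat \<Rightarrow> nat \<Rightarrow> graph \<Rightarrow> nat list \<Rightarrow> instr \<Rightarrow> config \<Rightarrow> config" where
  "exec w n H args (Const a x) s = set_cell a (x mod 2 ^ w) s"
| "exec w n H args (Copy a b) s = set_cell a (mem s b) s"
| "exec w n H args (Op f a b c) s = set_cell a (binop_val w f (mem s b) (mem s c)) s"
| "exec w n H args (Load a b) s = set_cell a (mem s (mem s b)) s"
| "exec w n H args (Store a b) s = set_cell (mem s a) (mem s b) s"
| "exec w n H args (Arg a j) s = set_cell a (if j < length args then args ! j else 0) s"
| "exec w n H args (NumV a) s = set_cell a n s"
| "exec w n H args (IsVert a b) s = set_cell a (of_bool (mem s b \<in> verts H)) s"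
| "exec w n H args (IsEdge a b c) s = set_cell a (of_bool ({mem s b, mem s c} \<in> edges H)) s"
| "exec w n H args (Output a) s = s\<lparr>pc := pc s + 1, out := out s @ [mem s a]\<rparr>"
| "exec w n H args (Jump l) s = s\<lparr>pc := l\<rparr>"
| "exec w n H args (JumpZero a l) s = s\<lparr>pc := (if mem s a = 0 then l else pc s + 1)\<rparr>"
| "exec w n H args (JumpLess a b l) s = s\<lparr>pc := (if mem s a < mem s b then l else pc s + 1)\<rparr>"
| "exec w n H args Halt s = s"

definition step :: "nat \<Rightarrow> nat \<Rightarrow> graph \<Rightarrow> nat list \<Rightarrow> program \<Rightarrow> config \<Rightarrow> config" where
  "step w n H args p s = (if halted p s then s else exec w n H args (p ! pc s) s)"

fun touched :: "instr \<Rightarrow> (nat \<Rightarrow> nat) \<Rightarrow> nat set" where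
  "touched (Const a x) M = {a}"
| "touched (Copy a b) M = {a, b}"
| "touched (Op f a b c) M = {a, b, c}"
| "touched (Load a b) M = {a, b, M b}"
| "touched (Store a b) M = {a, b, M a}"
| "touched (Arg a j) M = {a}"
| "touched (NumV a) M = {a}"
| "touched (IsVert a b) M = {a, b}"
| "touched (IsEdge a b c) M = {a, b, c}"
| "touched (Output a) M = {a}"
| "touched (Jump l) M = {}"
| "touched (JumpZero a l) M = {a}"
| "touched (JumpLess a b l) M = {a, b}"
| "touched Halt M = {}"

text \<open>Program \<open>p\<close> halts after at most \<open>t\<close> steps with output stream \<open>ys\<close>,
  accessing only the first \<open>m\<close> cells of the auxiliary memory.\<close>

definition computes ::
  "nat \<Rightarrow> program \<Rightarrow> nat \<Rightarrow> graph \<Rightarrow> nat list \<Rightarrow> nat list \<Rightarrow> nat \<Rightarrow> nat \<Rightarrow> bool" where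
  "computes w p n H args ys t m \<longleftrightarrow>
     (let run = (\<lambda>j. (step w n H args p ^^ j) init_config) in
        halted p (run t) \<and> out (run t) = ys \<and>
        (\<forall>j. \<not> halted p (run j) \<longrightarrow> touched (p ! pc (run j)) (mem (run j)) \<subseteq> {..<m}))"

text \<open>Words have \<open>\<kappa>\<close> times as many bits as are needed to write down \<open>n\<close>.\<close>

definition word_length :: "nat \<Rightarrow> nat \<Rightarrow> nat" where
  "word_length \<kappa> n = \<kappa> * nat \<lceil>log 2 (real n + 1)\<rceil>"

text \<open>The property of round \<open>i\<close> is decided by one program with oracle access to $G_{i-1}$ using at most
  \<open>c * log 2 n\<close> bits, where \<open>n\<close> is the number of vertices of $G$. The constant \<open>c\<close> bounds the
  length of the program as well, so that it is a common measure for finitely many properties.\<close>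

definition logspace_decidable ::
  "nat \<Rightarrow> nat \<Rightarrow> (nat \<Rightarrow> graph \<Rightarrow> nat \<Rightarrow> bool) \<Rightarrow> nat \<Rightarrow> bool" where
  "logspace_decidable \<kappa> c P i \<longleftrightarrow>
     (\<exists>p. length p \<le> c \<and>
        (\<forall>n\<ge>2. \<forall>G. simple_graph_on n G \<longrightarrow>
           (\<forall>v\<in>verts (layer P G (i - 1)). \<exists>t m.
              computes (word_length \<kappa> n) p n (layer P G (i - 1)) [v]
                [of_bool (P i (layer P G (i - 1)) v)] t m \<and>
              real (m * word_length \<kappa> n) \<le> real c * log 2 (real n))))"

text \<open>Time \<open>n ^ (C * i)\<close> and \<open>C * i * log 2 n\<close> bits of space.\<close>

definition solves ::
  "nat \<Rightarrow> nat \<Rightarrow> nat \<Rightarrow> program \<Rightarrow> nat \<Rightarrow> graph \<Rightarrow> nat list \<Rightarrow> (nat list \<Rightarrow> bool) \<Rightarrow> bool" where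
  "solves \<kappa> C i p n G args R \<longleftrightarrow>
     (\<exists>ys t m. computes (word_length \<kappa> n) p n G args ys t m \<and> R ys \<and>
        t \<le> n ^ (C * i) \<and> real (m * word_length \<kappa> n) \<le> real (C * i) * log 2 (real n))"

definition answers_vertex_queries ::
  "nat \<Rightarrow> nat \<Rightarrow> nat \<Rightarrow> program \<Rightarrow> nat \<Rightarrow> graph \<Rightarrow> nat set \<Rightarrow> bool" where
  "answers_vertex_queries \<kappa> C i p n G X \<longleftrightarrow>
     (\<forall>v\<in>verts G. solves \<kappa> C i p n G [v] (\<lambda>ys. ys = [of_bool (v \<in> X)]))"

definition answers_edge_queries ::
  "nat \<Rightarrow> nat \<Rightarrow> nat \<Rightarrow> program \<Rightarrow> nat \<Rightarrow> graph \<Rightarrow> nat set set \<Rightarrow> bool" where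
  "answers_edge_queries \<kappa> C i p n G F \<longleftrightarrow>
     (\<forall>u\<in>verts G. \<forall>v\<in>verts G. solves \<kappa> C i p n G [u, v] (\<lambda>ys. ys = [of_bool ({u, v} \<in> F)]))"

definition enumerates_vertices ::
  "nat \<Rightarrow> nat \<Rightarrow> nat \<Rightarrow> program \<Rightarrow> nat \<Rightarrow> graph \<Rightarrow> nat set \<Rightarrow> bool" where
  "enumerates_vertices \<kappa> C i p n G X \<longleftrightarrow>
     solves \<kappa> C i p n G [] (\<lambda>ys. distinct ys \<and> set ys = X)"

text \<open>An edge is output as two consecutive words, its endpoints in either order.\<close>

definition enumerates_edges ::
  "nat \<Rightarrow> nat \<Rightarrow> nat \<Rightarrow> program \<Rightarrow> nat \<Rightarrow> graph \<Rightarrow> nat set set \<Rightarrow> bool" where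
  "enumerates_edges \<kappa> C i p n G F \<longleftrightarrow>
     solves \<kappa> C i p n G []
       (\<lambda>ys. \<exists>es. ys = concat (map (\<lambda>(u, v). [u, v]) es) \<and>
          distinct (map (\<lambda>(u, v). {u, v}) es) \<and> set (map (\<lambda>(u, v). {u, v}) es) = F)"

end

theory Submission
  imports Defs
begin

text \<open>A program that uses \<open>c * log 2 n\<close> bits touches at most \<open>c\<close> words, so a halting run of it visits only
  \<open>n ^ O(1)\<close> configurations. Whether a vertex survives round \<open>i\<close> is decided by interpreting the program
  of round \<open>i\<close> in its own block of \<open>O(c)\<close> memory cells, where each oracle query to $G_{i-1}$ is
  answered by an inlined copy of the command for round \<open>i - 1\<close>; an edge of $G$ is in $G_{i-1}$ iff both its
  ends are. One more level thus costs a factor \<open>n ^ O(1)\<close> in time and \<open>O(1)\<close> additional words.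
  All sets are enumerated by filtering the vertices or pairs of vertices of \<open>G\<close>.\<close>

section \<open>Structured commands and their compilation\<close>

text \<open>The hypothesis bounds only the space of the given programs and promises halting only on
  vertices of the graph they are run on. Hence the guard in every round: a program is interpreted
  only after the vertex has been found to be still present, as the interpretation might otherwise
  not terminate. The bounds have to hold for every \<open>n \<ge> 2\<close> with one
  \<open>C\<close> that depends on \<open>\<kappa>\<close> and \<open>c\<close> alone, whereas the
  addresses of the blocks grow with the round and may exceed every word. So all addresses in the
  constructed programs are literals, indirect accesses become case distinctions, and constant
  factors are moved into exponents by \<open>a \<le> n ^ a\<close>. No layer is ever stored. A query
  recomputes its answer from arbitrary old contents of the lower blocks, so one block per round
  serves all calls.\<close>

datatype com =
    Skip
  | Do instr
  | Seq com com
  | IfNz nat com com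
  | IfLt nat nat com com
  | WhileNz nat com

fun com_size :: "com \<Rightarrow> nat" where
  "com_size Skip = 0"
| "com_size (Do _) = 1"
| "com_size (Seq a b) = com_size a + com_size b"
| "com_size (IfNz _ a b) = com_size a + com_size b + 2"
| "com_size (IfLt _ _ a b) = com_size a + com_size b + 2"
| "com_size (WhileNz _ a) = com_size a + 2"

text \<open>Jump targets are absolute, so \<open>l\<close> is the address at which the code will be
  placed. In \<open>IfLt\<close> the else-branch is laid out first, because \<open>JumpLess\<close>
  jumps when its comparison holds, whereas \<open>JumpZero\<close> jumps when the test of
  \<open>IfNz\<close> fails.\<close>

fun compile :: "nat \<Rightarrow> com \<Rightarrow> program" where
  "compile l Skip = []"
| "compile l (Do i) = [i]"
| "compile l (Seq a b) = compile l a @ compile (l + com_size a) b"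
| "compile l (IfNz x a b) =
     [JumpZero x (l + com_size a + 2)] @ compile (l + 1) a @
     [Jump (l + com_size a + 2 + com_size b)] @ compile (l + com_size a + 2) b"
| "compile l (IfLt x y a b) =
     [JumpLess x y (l + com_size b + 2)] @ compile (l + 1) b @
     [Jump (l + com_size b + 2 + com_size a)] @ compile (l + com_size b + 2) a"
| "compile l (WhileNz x a) =
     [JumpZero x (l + com_size a + 2)] @ compile (l + 1) a @ [Jump l]"

text \<open>Without \<open>Load\<close> and \<open>Store\<close> the accessed cells can be read off the program text.\<close>

fun straight :: "nat \<Rightarrow> instr \<Rightarrow> bool" where
  "straight m (Const a x) \<longleftrightarrow> a < m"
| "straight m (Copy a b) \<longleftrightarrow> a < m \<and> b < m"
| "straight m (Op f a b c) \<longleftrightarrow> a < m \<and> b < m \<and> c < m"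
| "straight m (Arg a j) \<longleftrightarrow> a < m"
| "straight m (NumV a) \<longleftrightarrow> a < m"
| "straight m (IsVert a b) \<longleftrightarrow> a < m \<and> b < m"
| "straight m (IsEdge a b c) \<longleftrightarrow> a < m \<and> b < m \<and> c < m"
| "straight m (Output a) \<longleftrightarrow> a < m"
| "straight m _ \<longleftrightarrow> False"

fun com_below :: "nat \<Rightarrow> com \<Rightarrow> bool" where
  "com_below m Skip \<longleftrightarrow> True"
| "com_below m (Do i) \<longleftrightarrow> straight m i"
| "com_below m (Seq a b) \<longleftrightarrow> com_below m a \<and> com_below m b"
| "com_below m (IfNz x a b) \<longleftrightarrow> x < m \<and> com_below m a \<and> com_below m b"
| "com_below m (IfLt x y a b) \<longleftrightarrow> x < m \<and> y < m \<and> com_below m a \<and> com_below m b"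
| "com_below m (WhileNz x a) \<longleftrightarrow> x < m \<and> com_below m a"

lemma straight_mono: "straight m i \<Longrightarrow> m \<le> m' \<Longrightarrow> straight m' i"
  by (cases i) auto

lemma com_below_mono: "com_below m c \<Longrightarrow> m \<le> m' \<Longrightarrow> com_below m' c"
  by (induction c) (auto intro: straight_mono)

lemma length_compile [simp]: "length (compile l c) = com_size c"
  by (induction c arbitrary: l) auto

lemma touched_compile:
  assumes "com_below m c" "i \<in> set (compile l c)"
  shows "touched i M \<subseteq> {..<m}"
proof -
  have straight: "touched i M \<subseteq> {..<m}" if "straight m i" for i
    using that by (cases i) auto
  show ?thesis
    using assms by (induction c arbitrary: l) (auto dest: straight split: if_splits)
qed

section \<open>Execution of compiled code inside a larger program\<close>

definition code_at :: "program \<Rightarrow> nat \<Rightarrow> program \<Rightarrow> bool" where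
  "code_at p l xs \<longleftrightarrow> (\<forall>k<length xs. l + k < length p \<and> p ! (l + k) = xs ! k)"

lemma code_at_append [simp]:
  "code_at p l (xs @ ys) \<longleftrightarrow> code_at p l xs \<and> code_at p (l + length xs) ys"
proof
  assume L: "code_at p l (xs @ ys)"
  show "code_at p l xs \<and> code_at p (l + length xs) ys"
    unfolding code_at_def
  proof safe
    fix k assume "k < length xs"
    then show "l + k < length p" "p ! (l + k) = xs ! k"
      using L[unfolded code_at_def, rule_format, of k] by (auto simp: nth_append)
  next
    fix k assume "k < length ys"
    then show "l + length xs + k < length p" "p ! (l + length xs + k) = ys ! k"
      using L[unfolded code_at_def, rule_format, of "length xs + k"]
      by (auto simp: nth_append add.assoc)
  qed
next
  assume R: "code_at p l xs \<and> code_at p (l + length xs) ys"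
  show "code_at p l (xs @ ys)"
    unfolding code_at_def
  proof (intro allI impI)
    fix k assume k: "k < length (xs @ ys)"
    show "l + k < length p \<and> p ! (l + k) = (xs @ ys) ! k"
    proof (cases "k < length xs")
      case True
      then show ?thesis using R by (auto simp: code_at_def nth_append)
    next
      case False
      then show ?thesis
        using R[THEN conjunct2, unfolded code_at_def, rule_format, of "k - length xs"] k
        by (auto simp: nth_append)
    qed
  qed
qed

lemma code_at_Cons [simp]:
  "code_at p l (x # ys) \<longleftrightarrow> l < length p \<and> p ! l = x \<and> code_at p (l + 1) ys"
  using code_at_append[of p l "[x]" ys] by (simp add: code_at_def)

locale machine =
  fixes w n :: nat and H :: graph and args :: "nat list"
begin

definition config_at :: "nat \<Rightarrow> (nat \<Rightarrow> nat) \<times> nat list \<Rightarrow> config" where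
  "config_at l s = \<lparr>pc = l, mem = fst s, out = snd s\<rparr>"

definition do_instr :: "instr \<Rightarrow> (nat \<Rightarrow> nat) \<times> nat list \<Rightarrow> (nat \<Rightarrow> nat) \<times> nat list" where
  "do_instr i s = (let s' = exec w n H args i (config_at 0 s) in (mem s', out s'))"

text \<open>\<open>runs c s B s'\<close>: command \<open>c\<close> leads from \<open>s\<close> to \<open>s'\<close>
  in at most \<open>B\<close> machine steps of the compiled code.\<close>

inductive runs :: "com \<Rightarrow> (nat \<Rightarrow> nat) \<times> nat list \<Rightarrow> nat \<Rightarrow> (nat \<Rightarrow> nat) \<times> nat list \<Rightarrow> bool"
where
  Skip: "runs Skip s B s"
| Do: "do_instr i s = s' \<Longrightarrow> 1 \<le> B \<Longrightarrow> runs (Do i) s B s'"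
| Seq: "runs a s B1 s1 \<Longrightarrow> runs b s1 B2 s2 \<Longrightarrow> B1 + B2 \<le> B \<Longrightarrow> runs (Seq a b) s B s2"
| IfNz_True: "fst s x \<noteq> 0 \<Longrightarrow> runs a s B1 s' \<Longrightarrow> B1 + 2 \<le> B \<Longrightarrow> runs (IfNz x a b) s B s'"
| IfNz_False: "fst s x = 0 \<Longrightarrow> runs b s B1 s' \<Longrightarrow> B1 + 2 \<le> B \<Longrightarrow> runs (IfNz x a b) s B s'"
| IfLt_True: "fst s x < fst s y \<Longrightarrow> runs a s B1 s' \<Longrightarrow> B1 + 2 \<le> B \<Longrightarrow> runs (IfLt x y a b) s B s'"
| IfLt_False: "\<not> fst s x < fst s y \<Longrightarrow> runs b s B1 s' \<Longrightarrow> B1 + 2 \<le> B \<Longrightarrow>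
    runs (IfLt x y a b) s B s'"
| While_False: "fst s x = 0 \<Longrightarrow> 1 \<le> B \<Longrightarrow> runs (WhileNz x a) s B s"
| While_True: "fst s x \<noteq> 0 \<Longrightarrow> runs a s B1 s1 \<Longrightarrow> runs (WhileNz x a) s1 B2 s2 \<Longrightarrow>
    B1 + B2 + 2 \<le> B \<Longrightarrow> runs (WhileNz x a) s B s2"

lemma runs_mono: "runs c s B s' \<Longrightarrow> B \<le> B' \<Longrightarrow> runs c s B' s'"
  by (induction arbitrary: B' rule: runs.induct) (force intro: runs.intros)+

lemma step_straight:
  assumes "straight m i" "l < length p" "p ! l = i"
  shows "step w n H args p (config_at l s) = config_at (l + 1) (do_instr i s)"
  using assms
  by (cases i) (auto simp: step_def halted_def config_at_def do_instr_def set_cell_def)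

lemma step_jumps:
  assumes "l < length p"
  shows "p ! l = Jump k \<Longrightarrow> step w n H args p (config_at l s) = config_at k s"
    and "p ! l = JumpZero x k \<Longrightarrow>
      step w n H args p (config_at l s) = config_at (if fst s x = 0 then k else l + 1) s"
    and "p ! l = JumpLess x y k \<Longrightarrow>
      step w n H args p (config_at l s) = config_at (if fst s x < fst s y then k else l + 1) s"
  using assms by (auto simp: step_def halted_def config_at_def)

definition reaches :: "program \<Rightarrow> nat \<Rightarrow> config \<Rightarrow> config \<Rightarrow> bool" where
  "reaches p B s s' \<longleftrightarrow> (\<exists>t\<le>B. (step w n H args p ^^ t) s = s')"

lemma reaches_refl: "reaches p B s s"
  unfolding reaches_def by (intro exI[of _ 0]) auto

lemma reaches_step: "step w n H args p s = s' \<Longrightarrow> 1 \<le> B \<Longrightarrow> reaches p B s s'"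
  unfolding reaches_def by (intro exI[of _ 1]) auto

lemma reaches_trans:
  assumes "reaches p B1 s s1" "reaches p B2 s1 s2" "B1 + B2 \<le> B"
  shows "reaches p B s s2"
proof -
  obtain t1 t2 where "t1 \<le> B1" "(step w n H args p ^^ t1) s = s1"
    "t2 \<le> B2" "(step w n H args p ^^ t2) s1 = s2"
    using assms by (auto simp: reaches_def)
  then show ?thesis
    unfolding reaches_def using assms(3)
    by (intro exI[of _ "t2 + t1"]) (auto simp: funpow_add)
qed

text \<open>The code may sit anywhere in \<open>p\<close>: the induction needs this for subcommands,
  whose code is surrounded by that of the others.\<close>

lemma runs_compile:
  assumes "runs c s B s'" "com_below m c" "code_at p l (compile l c)"
  shows "reaches p B (config_at l s) (config_at (l + com_size c) s')"
  using assms
proof (induction arbitrary: l rule: runs.induct)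
  case (Skip s B)
  then show ?case by (simp add: reaches_refl)
next
  case (Do i s s' B)
  then show ?case by (auto intro!: reaches_step simp: step_straight)
next
  case (Seq a s B1 s1 b B2 s2 B)
  from Seq have "reaches p B1 (config_at l s) (config_at (l + com_size a) s1)"
    and "reaches p B2 (config_at (l + com_size a) s1) (config_at (l + com_size a + com_size b) s2)"
    by auto
  from reaches_trans[OF this Seq.hyps(3)] show ?case by (simp add: add.assoc)
next
  case (IfNz_True s x a B1 s' B b)
  from IfNz_True have 1: "reaches p 1 (config_at l s) (config_at (l + 1) s)"
    by (intro reaches_step) (auto simp: step_jumps)
  from IfNz_True have 2: "reaches p B1 (config_at (l + 1) s) (config_at (l + 1 + com_size a) s')"
    using IfNz_True.IH[of "l + 1"] by auto
  from IfNz_True have 3: "reaches p 1 (config_at (l + 1 + com_size a) s')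
      (config_at (l + com_size (IfNz x a b)) s')"
    by (intro reaches_step) (auto simp: step_jumps add_ac)
  show ?case using reaches_trans[OF reaches_trans[OF 1 2 order_refl] 3] IfNz_True.hyps by auto
next
  case (IfNz_False s x b B1 s' B a)
  from IfNz_False have 1: "reaches p 1 (config_at l s) (config_at (l + com_size a + 2) s)"
    by (intro reaches_step) (auto simp: step_jumps)
  from IfNz_False have 2: "reaches p B1 (config_at (l + com_size a + 2) s)
      (config_at (l + com_size a + 2 + com_size b) s')"
    using IfNz_False.IH[of "l + com_size a + 2"] by auto
  show ?case using reaches_trans[OF 1 2] IfNz_False.hyps by (auto simp: add_ac)
next
  case (IfLt_True s x y a B1 s' B b)
  from IfLt_True have 1: "reaches p 1 (config_at l s) (config_at (l + com_size b + 2) s)"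
    by (intro reaches_step) (auto simp: step_jumps)
  from IfLt_True have 2: "reaches p B1 (config_at (l + com_size b + 2) s)
      (config_at (l + com_size b + 2 + com_size a) s')"
    using IfLt_True.IH[of "l + com_size b + 2"] by auto
  show ?case using reaches_trans[OF 1 2] IfLt_True.hyps by (auto simp: add_ac)
next
  case (IfLt_False s x y b B1 s' B a)
  from IfLt_False have 1: "reaches p 1 (config_at l s) (config_at (l + 1) s)"
    by (intro reaches_step) (auto simp: step_jumps)
  from IfLt_False have 2: "reaches p B1 (config_at (l + 1) s) (config_at (l + 1 + com_size b) s')"
    using IfLt_False.IH[of "l + 1"] by auto
  from IfLt_False have 3: "reaches p 1 (config_at (l + 1 + com_size b) s')
      (config_at (l + com_size (IfLt x y a b)) s')"
    by (intro reaches_step) (auto simp: step_jumps add_ac)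
  show ?case using reaches_trans[OF reaches_trans[OF 1 2 order_refl] 3] IfLt_False.hyps by auto
next
  case (While_False s x B a)
  then show ?case by (intro reaches_step) (auto simp: step_jumps)
next
  case (While_True s x a B1 s1 B2 s2 B)
  from While_True have 1: "reaches p 1 (config_at l s) (config_at (l + 1) s)"
    by (intro reaches_step) (auto simp: step_jumps)
  from While_True have 2: "reaches p B1 (config_at (l + 1) s) (config_at (l + 1 + com_size a) s1)"
    using While_True.IH(1)[of "l + 1"] by auto
  from While_True have 3: "reaches p 1 (config_at (l + 1 + com_size a) s1) (config_at l s1)"
    by (intro reaches_step) (auto simp: step_jumps)
  from While_True have 4: "reaches p B2 (config_at l s1) (config_at (l + com_size (WhileNz x a)) s2)"
    by blast
  show ?case
    using reaches_trans[OF reaches_trans[OF reaches_trans[OF 1 2 order_refl] 3 order_refl] 4]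
      While_True.hyps by auto
qed

end

lemma funpow_step_halted: "halted p s \<Longrightarrow> (step w n H args p ^^ j) s = s"
  by (induction j) (auto simp: step_def)

context machine
begin

text \<open>A halted configuration is a fixed point of \<open>step\<close>, so the result can be
  read off at any \<open>t \<ge> B\<close>. The space condition speaks about all times, but
  \<open>com_below\<close> bounds every instruction of the code, whichever of them are
  reached.\<close>

lemma computes_compile:
  assumes "runs c (\<lambda>_. 0, []) B (M, ys)" "com_below m c" "B \<le> t"
  shows "computes w (compile 0 c) n H args ys t m"
proof -
  let ?p = "compile 0 c"
  let ?run = "\<lambda>j. (step w n H args ?p ^^ j) init_config"
  have "code_at ?p 0 (compile 0 c)" by (auto simp: code_at_def)
  from runs_compile[OF assms(1,2) this] obtain t0 where t0: "t0 \<le> B"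
    "?run t0 = config_at (com_size c) (M, ys)"
    by (auto simp: reaches_def config_at_def init_config_def)
  then have h: "halted ?p (?run t0)" by (simp add: halted_def config_at_def)
  have "?run t = (step w n H args ?p ^^ (t - t0)) (?run t0)"
    using t0 assms(3) funpow_add[of "t - t0" t0 "step w n H args ?p"] by simp
  then have eq: "?run t = ?run t0"
    using funpow_step_halted[OF h] by simp
  have "touched (?p ! pc s) M' \<subseteq> {..<m}" if "\<not> halted ?p s" for s M'
    using that assms(2) by (intro touched_compile[where l = 0 and c = c]) (auto simp: halted_def)
  then show ?thesis
    using h t0 eq by (auto simp: computes_def config_at_def)
qed

end

section \<open>Running time of halting programs\<close>

text \<open>\<open>Div\<close>, \<open>Mod\<close> and \<open>Shr\<close> are not reduced modulo
  \<open>2 ^ w\<close>, but never exceed \<open>x\<close>, even for divisor 0. The bitwise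
  operations commute with truncation to \<open>w\<close> bits.\<close>

lemma binop_val_less:
  assumes "x < 2 ^ w" "y < 2 ^ w"
  shows "binop_val w f x y < 2 ^ w"
proof -
  have bits: "take_bit w x = x" "take_bit w y = y"
    using assms by (simp_all add: take_bit_nat_eq_self)
  have bound: "z < 2 ^ w" if "take_bit w z = z" for z :: nat
    using that by (metis take_bit_nat_less_exp)
  show ?thesis
  proof (cases f)
    case Sub
    have "(int x - int y) mod 2 ^ w < 2 ^ w" by simp
    then show ?thesis using Sub by (simp add: nat_less_iff)
  next
    case Div
    then show ?thesis using assms by (simp add: le_less_trans[OF div_le_dividend])
  next
    case Mod
    then show ?thesis using assms by (simp add: le_less_trans[OF mod_less_eq_dividend])
  next
    case Shr
    have "drop_bit y x \<le> x" by (simp add: drop_bit_eq_div)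
    then show ?thesis using assms Shr by simp
  qed (auto intro!: bound simp: bits)
qed

lemma exec_words:
  assumes "\<forall>a. mem s a < 2 ^ w" "n < 2 ^ w" "1 \<le> w" "\<forall>x\<in>set args. x < 2 ^ w"
  shows "mem (exec w n H args i s) a < 2 ^ w"
proof -
  \<comment> \<open>The answers of \<open>IsVert\<close> and \<open>IsEdge\<close> have to fit into
    a word.\<close>
  have "(1::nat) < 2 ^ w" using assms(3) one_less_power[of "2::nat" w] by simp
  then show ?thesis
    using assms by (cases i) (auto simp: set_cell_def binop_val_less)
qed

lemma run_words:
  assumes "n < 2 ^ w" "1 \<le> w" "\<forall>x\<in>set args. x < 2 ^ w"
  shows "mem ((step w n H args p ^^ j) init_config) a < 2 ^ w"
proof (induction j arbitrary: a)
  case (Suc j)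
  then show ?case using assms by (auto simp: step_def exec_words)
qed (simp add: init_config_def)

lemma exec_untouched:
  "a \<notin> touched i (mem s) \<Longrightarrow> mem (exec w n H args i s) a = mem s a"
  by (cases i) (auto simp: set_cell_def)

text \<open>The output cannot be read back, so it does not influence the run. This is why it can be
  left out when configurations are counted.\<close>

lemma step_cong:
  assumes "pc s = pc s'" "mem s = mem s'"
  shows "pc (step w n H args p s) = pc (step w n H args p s') \<and>
    mem (step w n H args p s) = mem (step w n H args p s')"
  using assms by (cases "p ! pc s'") (auto simp: step_def halted_def set_cell_def)

lemma funpow_step_cong:
  assumes "pc s = pc s'" "mem s = mem s'"
  shows "pc ((step w n H args p ^^ d) s) = pc ((step w n H args p ^^ d) s') \<and>
    mem ((step w n H args p ^^ d) s) = mem ((step w n H args p ^^ d) s')"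
proof (induction d)
  case (Suc d)
  then show ?case using step_cong[of "(step w n H args p ^^ d) s" "(step w n H args p ^^ d) s'"] by simp
qed (use assms in auto)

text \<open>A halting run never repeats its pair of program counter and memory.\<close>

lemma halting_time_bound:
  assumes comp: "computes w p n H args ys t m"
    and words: "n < 2 ^ w" "1 \<le> w" "\<forall>x\<in>set args. x < 2 ^ w"
  defines "run \<equiv> \<lambda>j. (step w n H args p ^^ j) init_config"
  shows "\<exists>T \<le> length p * (2 ^ w) ^ m. halted p (run T) \<and> out (run T) = ys \<and>
    (\<forall>j<T. \<not> halted p (run j))"
proof -
  have halts: "halted p (run t)" "out (run t) = ys"
    and touch: "\<And>j. \<not> halted p (run j) \<Longrightarrow> touched (p ! pc (run j)) (mem (run j)) \<subseteq> {..<m}"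
    using comp by (auto simp: computes_def run_def)
  \<comment> \<open>\<open>t\<close> may lie long after the program has halted; only the first
    halting time can be bounded by counting.\<close>
  define T where "T = (LEAST T. halted p (run T))"
  have T: "halted p (run T)" "T \<le> t" and least: "\<And>j. j < T \<Longrightarrow> \<not> halted p (run j)"
    using halts LeastI[of "\<lambda>T. halted p (run T)" t] Least_le[of "\<lambda>T. halted p (run T)" t]
      not_less_Least by (auto simp: T_def)
  have add: "run (d + j) = (step w n H args p ^^ d) (run j)" for d j
    by (simp add: run_def funpow_add)
  have out_T: "out (run T) = ys"
    using add[of "t - T" T] funpow_step_halted[OF T(1)] T(2) halts(2) by simp
  \<comment> \<open>Cells from \<open>m\<close> on keep their initial 0, so \<open>m\<close> words
    describe the whole memory.\<close>
  have zero: "mem (run j) a = 0" if "m \<le> a" for j a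
  proof (induction j)
    case (Suc j)
    have "a \<notin> touched (p ! pc (run j)) (mem (run j))" if "\<not> halted p (run j)"
      using touch[OF that] \<open>m \<le> a\<close> by auto
    then show ?case
      using Suc add[of 1 j] exec_untouched[of a "p ! pc (run j)" "run j"] by (auto simp: step_def)
  qed (simp add: run_def init_config_def)
  define key where "key j = (pc (run j), map (mem (run j)) [0..<m])" for j
  have inj: "inj_on key {..<T}"
  proof (rule linorder_inj_onI')
    fix i j assume ij: "i \<in> {..<T}" "j \<in> {..<T}" "i < j"
    show "key i \<noteq> key j"
    proof
      assume eq: "key i = key j"
      then have pc: "pc (run i) = pc (run j)" by (simp add: key_def)
      have "mem (run i) a = mem (run j) a" for a
        using eq zero[of a i] zero[of a j] by (cases "a < m") (auto simp: key_def)
      then have "mem (run i) = mem (run j)" by auto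
      \<comment> \<open>From time \<open>i\<close> on the run would behave as from time
        \<open>j\<close> on and hence halt \<open>T - j\<close> steps after \<open>i\<close>, which
        is before \<open>T\<close>.\<close>
      from funpow_step_cong[OF pc this, where w = w and n = n and H = H and args = args and p = p and d = "T - j"]
      have "pc (run (T - j + i)) = pc (run T)"
        using ij add[of "T - j" i] add[of "T - j" j] by simp
      then have "halted p (run (T - j + i))" using T by (simp add: halted_def)
      moreover have "T - j + i < T" using ij by auto
      ultimately show False using least by blast
    qed
  qed
  let ?K = "{..<length p} \<times> {xs. set xs \<subseteq> {..<(2::nat) ^ w} \<and> length xs = m}"
  have sub: "key ` {..<T} \<subseteq> ?K"
    using least run_words[OF words] by (auto simp: key_def halted_def run_def not_le)
  have fin: "finite ?K"
    by (intro finite_cartesian_product finite_lists_length_eq) auto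
  have "card {..<T} = card (key ` {..<T})"
    using inj by (simp add: card_image)
  also have "\<dots> \<le> card ?K"
    using fin sub by (rule card_mono)
  also have "\<dots> = length p * (2 ^ w) ^ m"
    by (simp add: card_cartesian_product card_lists_length_eq)
  finally show ?thesis using T(1) out_T least by (intro exI[of _ T]) auto
qed

section \<open>Interpreting a program with inlined oracle queries\<close>

text \<open>Memory layout of the interpreter with base address \<open>b\<close>: argument, result, scratch cell,
  running flag, \<open>c + 1\<close> cells for the interpreted memory (addresses from \<open>c\<close> on are never accessed
  and collapse to one cell), and one flag per instruction, which marks the interpreted program counter.
  For small \<open>n\<close> the words are too short to hold a program counter or an address.\<close>

definition sim_cell :: "nat \<Rightarrow> nat \<Rightarrow> nat \<Rightarrow> nat" where
  "sim_cell c b a = b + 4 + min a c"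

definition sim_flag :: "nat \<Rightarrow> nat \<Rightarrow> nat \<Rightarrow> nat" where
  "sim_flag c b l = b + 5 + c + l"

text \<open>Replaces indirect addressing: runs \<open>f x\<close> where \<open>x\<close> is the content of cell \<open>y\<close>, provided
  that \<open>d \<le> x \<le> d + k\<close>. Testing the candidates in increasing order makes the reduction of the
  constants modulo \<open>2 ^ w\<close> harmless.\<close>

primrec select :: "nat \<Rightarrow> nat \<Rightarrow> (nat \<Rightarrow> com) \<Rightarrow> nat \<Rightarrow> nat \<Rightarrow> com" where
  "select t y f 0 d = f d"
| "select t y f (Suc k) d =
     Seq (Do (Const t d)) (IfLt t y (select t y f k (Suc d)) (f d))"

definition vertex_query :: "com \<Rightarrow> nat \<Rightarrow> nat \<Rightarrow> nat \<Rightarrow> com" where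
  "vertex_query q b' a u = Seq (Do (Copy b' u)) (Seq q (Do (Copy a (Suc b'))))"

text \<open>Both queries use the same block, so the first answer is branched on before the second
  query overwrites it. The endpoints are meant to lie in cells that \<open>q\<close>
  preserves.\<close>

definition edge_query :: "com \<Rightarrow> nat \<Rightarrow> nat \<Rightarrow> nat \<Rightarrow> nat \<Rightarrow> com" where
  "edge_query q b' a u v =
     Seq (Do (Copy b' u)) (Seq q (IfNz (Suc b')
       (Seq (Do (Copy b' v)) (Seq q (IfNz (Suc b') (Do (IsEdge a u v)) (Do (Const a 0)))))
       (Do (Const a 0))))"

text \<open>\<open>Output\<close> is redirected to the result cell: the answer of the interpreted
  program is an intermediate result and must not enter the write-only stream. Overwriting suffices
  because a run outputs a single word. As there is one argument only, \<open>Arg\<close> with a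
  positive index yields the default 0 of \<open>exec\<close>.\<close>

fun sim_data :: "nat \<Rightarrow> nat \<Rightarrow> com \<Rightarrow> nat \<Rightarrow> instr \<Rightarrow> com" where
  "sim_data c b q b' (Const a x) = Do (Const (sim_cell c b a) x)"
| "sim_data c b q b' (Copy a d) = Do (Copy (sim_cell c b a) (sim_cell c b d))"
| "sim_data c b q b' (Op f a d e) = Do (Op f (sim_cell c b a) (sim_cell c b d) (sim_cell c b e))"
| "sim_data c b q b' (Load a d) =
     select (b + 2) (sim_cell c b d) (\<lambda>x. Do (Copy (sim_cell c b a) (sim_cell c b x))) c 0"
| "sim_data c b q b' (Store a d) =
     select (b + 2) (sim_cell c b a) (\<lambda>x. Do (Copy (sim_cell c b x) (sim_cell c b d))) c 0"
| "sim_data c b q b' (Arg a j) =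
     Do (if j = 0 then Copy (sim_cell c b a) b else Const (sim_cell c b a) 0)"
| "sim_data c b q b' (NumV a) = Do (NumV (sim_cell c b a))"
| "sim_data c b q b' (IsVert a d) = vertex_query q b' (sim_cell c b a) (sim_cell c b d)"
| "sim_data c b q b' (IsEdge a d e) =
     edge_query q b' (sim_cell c b a) (sim_cell c b d) (sim_cell c b e)"
| "sim_data c b q b' (Output a) = Do (Copy (b + 1) (sim_cell c b a))"
| "sim_data c b q b' _ = Skip"

text \<open>Whether \<open>l\<close> is a halting position is known from the text of
  \<open>p\<close>, so the test is made while the command is built, not while it runs.\<close>

definition sim_goto :: "nat \<Rightarrow> nat \<Rightarrow> program \<Rightarrow> nat \<Rightarrow> com" where
  "sim_goto c b p l =
     Do (if l < length p \<and> p ! l \<noteq> Halt then Const (sim_flag c b l) 1 else Const (b + 3) 0)"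

fun sim_ctrl :: "nat \<Rightarrow> nat \<Rightarrow> program \<Rightarrow> nat \<Rightarrow> instr \<Rightarrow> com" where
  "sim_ctrl c b p l (Jump k) = sim_goto c b p k"
| "sim_ctrl c b p l (JumpZero a k) =
     IfNz (sim_cell c b a) (sim_goto c b p (l + 1)) (sim_goto c b p k)"
| "sim_ctrl c b p l (JumpLess a d k) =
     IfLt (sim_cell c b a) (sim_cell c b d) (sim_goto c b p k) (sim_goto c b p (l + 1))"
| "sim_ctrl c b p l _ = sim_goto c b p (l + 1)"

text \<open>The remaining flags are tested only in the else-branch, so a flag set by the executed
  instruction is not seen in the same pass. The old flag is cleared before control sets the new one,
  which makes a jump of an instruction to itself work.\<close>

primrec sim_dispatch :: "nat \<Rightarrow> nat \<Rightarrow> com \<Rightarrow> nat \<Rightarrow> program \<Rightarrow> nat list \<Rightarrow> com" where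
  "sim_dispatch c b q b' p [] = Skip"
| "sim_dispatch c b q b' p (l # ls) = IfNz (sim_flag c b l)
     (Seq (sim_data c b q b' (p ! l)) (Seq (Do (Const (sim_flag c b l) 0)) (sim_ctrl c b p l (p ! l))))
     (sim_dispatch c b q b' p ls)"

primrec clear :: "nat list \<Rightarrow> com" where
  "clear [] = Skip"
| "clear (a # xs) = Seq (Do (Const a 0)) (clear xs)"

text \<open>The block still holds the traces of earlier calls, whereas the interpreted program
  expects memory filled with 0.\<close>

definition sim_init :: "nat \<Rightarrow> nat \<Rightarrow> program \<Rightarrow> com" where
  "sim_init c b p =
     Seq (clear ((b + 1) # map (sim_cell c b) [0..<c] @ map (sim_flag c b) [0..<length p]))
       (Seq (Do (Const (b + 3) 1)) (sim_goto c b p 0))"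

definition sim :: "nat \<Rightarrow> nat \<Rightarrow> com \<Rightarrow> nat \<Rightarrow> program \<Rightarrow> com" where
  "sim c b q b' p =
     Seq (sim_init c b p) (WhileNz (b + 3) (sim_dispatch c b q b' p [0..<length p]))"

section \<open>Correctness and running time of the interpreter\<close>

context machine
begin

text \<open>\<open>q\<close> answers vertex queries to \<open>X\<close> in time \<open>B\<close>, with argument in cell \<open>b'\<close> and
  answer in cell \<open>Suc b'\<close>, changing only cells below \<open>b\<close>.\<close>

definition answers :: "com \<Rightarrow> nat \<Rightarrow> nat \<Rightarrow> nat set \<Rightarrow> nat \<Rightarrow> bool" where
  "answers q b' b X B \<longleftrightarrow> Suc b' < b \<and> (\<forall>M ys. \<exists>M'. runs q (M, ys) B (M', ys) \<and>
     M' (Suc b') = of_bool (M b' \<in> X) \<and> (\<forall>a\<ge>b. M' a = M a))"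

lemma do_instr_simps [simp]:
  "do_instr (Const a x) (M, ys) = (M(a := x mod 2 ^ w), ys)"
  "do_instr (Copy a d) (M, ys) = (M(a := M d), ys)"
  "do_instr (Op f a d e) (M, ys) = (M(a := binop_val w f (M d) (M e)), ys)"
  "do_instr (Arg a j) (M, ys) = (M(a := if j < length args then args ! j else 0), ys)"
  "do_instr (NumV a) (M, ys) = (M(a := n), ys)"
  "do_instr (IsVert a d) (M, ys) = (M(a := of_bool (M d \<in> verts H)), ys)"
  "do_instr (IsEdge a d e) (M, ys) = (M(a := of_bool ({M d, M e} \<in> edges H)), ys)"
  "do_instr (Output a) (M, ys) = (M, ys @ [M a])"
  by (simp_all add: do_instr_def config_at_def set_cell_def)

lemma runs_Do: "do_instr i s = s' \<Longrightarrow> runs (Do i) s 1 s'"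
  by (rule runs.Do) auto

lemma runs_vertex_query:
  assumes "answers q b' b X B" "b \<le> a" "b \<le> u"
  shows "\<exists>M'. runs (vertex_query q b' a u) (M, ys) (B + 2) (M', ys) \<and>
    M' a = of_bool (M u \<in> X) \<and> (\<forall>e\<ge>b. e \<noteq> a \<longrightarrow> M' e = M e)"
proof -
  obtain M1 where M1: "runs q (M(b' := M u), ys) B (M1, ys)"
    "M1 (Suc b') = of_bool (M u \<in> X)" "\<forall>e\<ge>b. M1 e = (M(b' := M u)) e" and "Suc b' < b"
    using assms(1) unfolding answers_def by (metis fun_upd_same)
  have "runs (vertex_query q b' a u) (M, ys) (B + 2) (M1(a := M1 (Suc b')), ys)"
    unfolding vertex_query_def
    by (rule runs.Seq[OF runs_Do runs.Seq[OF M1(1) runs_Do]]) auto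
  then show ?thesis using M1 \<open>Suc b' < b\<close> by (intro exI[of _ "M1(a := M1 (Suc b'))"] conjI) auto
qed

lemma runs_edge_query:
  assumes "answers q b' b X B" "b \<le> a" "b \<le> u" "b \<le> v"
  shows "\<exists>M'. runs (edge_query q b' a u v) (M, ys) (2 * B + 7) (M', ys) \<and>
    M' a = of_bool (M u \<in> X \<and> M v \<in> X \<and> {M u, M v} \<in> edges H) \<and>
    (\<forall>e\<ge>b. e \<noteq> a \<longrightarrow> M' e = M e)"
proof -
  obtain M1 where M1: "runs q (M(b' := M u), ys) B (M1, ys)"
    "M1 (Suc b') = of_bool (M u \<in> X)" "\<forall>e\<ge>b. M1 e = (M(b' := M u)) e" and b: "Suc b' < b"
    using assms(1) unfolding answers_def by (metis fun_upd_same)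
  obtain M2 where M2: "runs q (M1(b' := M1 v), ys) B (M2, ys)"
    "M2 (Suc b') = of_bool (M1 v \<in> X)" "\<forall>e\<ge>b. M2 e = (M1(b' := M1 v)) e"
    using assms(1) unfolding answers_def by (metis fun_upd_same)
  have eqs: "\<And>e. b \<le> e \<Longrightarrow> M1 e = M e" "\<And>e. b \<le> e \<Longrightarrow> M2 e = M e"
    using M1 M2 b by auto
  show ?thesis
  proof (cases "M u \<in> X")
    case False
    then have "runs (edge_query q b' a u v) (M, ys) (2 * B + 7) (M1(a := 0), ys)"
      unfolding edge_query_def
      by (intro runs.Seq[OF runs_Do runs.Seq[OF M1(1) runs.IfNz_False[OF _ runs_Do]]])
        (auto simp: M1)
    then show ?thesis using False eqs by (intro exI[of _ "M1(a := 0)"] conjI) auto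
  next
    case u: True
    let ?y = "of_bool (M v \<in> X \<and> {M u, M v} \<in> edges H) :: nat"
    have "runs (IfNz (Suc b') (Do (IsEdge a u v)) (Do (Const a 0))) (M2, ys) 3 (M2(a := ?y), ys)"
    proof (cases "M v \<in> X")
      case True
      then show ?thesis using M2 eqs assms by (intro runs.IfNz_True[OF _ runs_Do]) auto
    next
      case False
      then show ?thesis using M2 eqs assms by (intro runs.IfNz_False[OF _ runs_Do]) auto
    qed
    note 1 = runs.Seq[OF runs_Do runs.Seq[OF M2(1) this order_refl] order_refl]
    have "runs (edge_query q b' a u v) (M, ys) (2 * B + 7) (M2(a := ?y), ys)"
      unfolding edge_query_def
      using u by (intro runs.Seq[OF runs_Do runs.Seq[OF M1(1) runs.IfNz_True[OF _ 1]]])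
        (auto simp: M1)
    then show ?thesis using u eqs by (intro exI[of _ "M2(a := ?y)"] conjI) auto
  qed
qed

text \<open>The contents of the scratch cell \<open>t\<close> are arbitrary before and after,
  because each level of the case distinction leaves another constant there. A level costs three
  steps: one for the constant and at most two for the branch.\<close>

lemma runs_select:
  assumes body: "\<And>z. \<exists>z'. runs (f (M y)) (M(t := z), ys) B (N(t := z'), ys)"
    and "t \<noteq> y" "M y < 2 ^ w" "d \<le> M y" "M y \<le> d + k"
  shows "\<exists>z'. runs (select t y f k d) (M(t := z), ys) (3 * k + B) (N(t := z'), ys)"
  using assms(4,5)
proof (induction k arbitrary: d z)
  case 0
  then have "M y = d" by simp
  then show ?case using body[of z] unfolding select.simps mult_0_right add_0 by metis
next
  case (Suc k)
  have d: "d mod 2 ^ w = d" using Suc.prems assms(3) by simp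
  show ?case
  proof (cases "d < M y")
    case True
    then have "Suc d \<le> M y" "M y \<le> Suc d + k" using Suc.prems by auto
    from Suc.IH[OF this] obtain z'
      where "runs (select t y f k (Suc d)) (M(t := d), ys) (3 * k + B) (N(t := z'), ys)" by blast
    then have "runs (select t y f (Suc k) d) (M(t := z), ys) (3 * Suc k + B) (N(t := z'), ys)"
      unfolding select.simps
      by (intro runs.Seq[OF runs_Do runs.IfLt_True[OF _ _ order_refl]]) (use True assms(2) d in auto)
    then show ?thesis ..
  next
    case False
    then have "M y = d" using Suc.prems by simp
    then obtain z' where "runs (f d) (M(t := d), ys) B (N(t := z'), ys)"
      using body by metis
    then have "runs (select t y f (Suc k) d) (M(t := z), ys) (3 * Suc k + B) (N(t := z'), ys)"
      unfolding select.simps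
      by (intro runs.Seq[OF runs_Do runs.IfLt_False[OF _ _ order_refl]]) (use False assms(2) d in auto)
    then show ?thesis ..
  qed
qed

lemma runs_clear: "runs (clear xs) (M, ys) (length xs) (\<lambda>a. if a \<in> set xs then 0 else M a, ys)"
proof (induction xs arbitrary: M)
  case Nil
  then show ?case by (simp add: runs.Skip)
next
  case (Cons a xs)
  have eq: "(\<lambda>e. if e \<in> set (a # xs) then 0 else M e) = (\<lambda>e. if e \<in> set xs then 0 else (M(a := 0)) e)"
    by auto
  show ?case unfolding eq clear.simps by (rule runs.Seq[OF runs_Do Cons.IH]) auto
qed

end

text \<open>The result cell mirrors the last word output; the value 0 for empty output is what the
  initial clearing leaves there.\<close>

definition sim_state :: "nat \<Rightarrow> nat \<Rightarrow> nat \<Rightarrow> config \<Rightarrow> (nat \<Rightarrow> nat) \<Rightarrow> bool" where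
  "sim_state c b v \<sigma> M \<longleftrightarrow> (\<forall>a<c. M (sim_cell c b a) = mem \<sigma> a) \<and> M b = v \<and>
     M (Suc b) = (if out \<sigma> = [] then 0 else last (out \<sigma>))"

text \<open>The flags encode the program counter only while the program runs: at a
  \<open>Halt\<close> inside the code no flag is set.\<close>

definition sim_rel :: "nat \<Rightarrow> nat \<Rightarrow> nat \<Rightarrow> program \<Rightarrow> config \<Rightarrow> (nat \<Rightarrow> nat) \<Rightarrow> bool" where
  "sim_rel c b v p \<sigma> M \<longleftrightarrow> sim_state c b v \<sigma> M \<and> M (b + 3) = of_bool (\<not> halted p \<sigma>) \<and>
     (\<not> halted p \<sigma> \<longrightarrow> (\<forall>l<length p. M (sim_flag c b l) = of_bool (l = pc \<sigma>)))"

lemma sim_state_set_cell: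
  assumes "sim_state c b v \<sigma> M" "a < c" "M' (sim_cell c b a) = x"
    and "\<forall>e\<ge>b. e \<noteq> b + 2 \<longrightarrow> e \<noteq> sim_cell c b a \<longrightarrow> M' e = M e"
  shows "sim_state c b v (set_cell a x \<sigma>) M'"
  using assms by (auto simp: sim_state_def set_cell_def sim_cell_def)

context machine
begin

text \<open>By the hypothesis on edges, a pair is an edge of \<open>H'\<close> iff it is an edge of
  \<open>H\<close> with both ends in \<open>H'\<close>; so \<open>IsEdge\<close> reads
  \<open>H\<close> after two vertex queries. The bound covers both expensive cases, an edge query
  with \<open>2 * B + 7\<close> steps and a \<open>select\<close> with
  \<open>3 * c + 1\<close>.\<close>

lemma runs_sim_data:
  assumes q: "answers q b' b (verts H') B"
    and edges: "\<And>u v. {u, v} \<in> edges H' \<longleftrightarrow> u \<in> verts H' \<and> v \<in> verts H' \<and> {u, v} \<in> edges H"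
    and touch: "touched i (mem \<sigma>) \<subseteq> {..<c}"
    and words: "\<forall>a. mem \<sigma> a < 2 ^ w"
    and st: "sim_state c b v \<sigma> M"
  shows "\<exists>M'. runs (sim_data c b q b' i) (M, ys) (2 * B + 3 * c + 7) (M', ys) \<and>
    sim_state c b v (exec w n H' [v] i \<sigma>) M' \<and>
    (\<forall>e. e = b + 3 \<or> b + 5 + c \<le> e \<longrightarrow> M' e = M e)"
proof -
  have cell: "M (sim_cell c b a) = mem \<sigma> a" if "a < c" for a
    using st that by (simp add: sim_state_def)
  have Mb: "M b = v" using st by (simp add: sim_state_def)
  have ge: "b \<le> sim_cell c b a" "sim_cell c b a \<noteq> b + 2" "b + 2 \<noteq> sim_cell c b a" for a
    by (auto simp: sim_cell_def)
  have fin: ?thesis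
    if "runs (sim_data c b q b' i) (M, ys) B0 (M', ys)" "B0 \<le> 2 * B + 3 * c + 7"
      "exec w n H' [v] i \<sigma> = set_cell a x \<sigma>" "a < c" "M' (sim_cell c b a) = x"
      "\<forall>e\<ge>b. e \<noteq> b + 2 \<longrightarrow> e \<noteq> sim_cell c b a \<longrightarrow> M' e = M e" for B0 M' a x
  proof (intro exI conjI)
    show "runs (sim_data c b q b' i) (M, ys) (2 * B + 3 * c + 7) (M', ys)"
      using that by (rule_tac runs_mono)
    show "sim_state c b v (exec w n H' [v] i \<sigma>) M'"
      unfolding that(3) using st that(4-6) by (rule sim_state_set_cell)
    show "\<forall>e. e = b + 3 \<or> b + 5 + c \<le> e \<longrightarrow> M' e = M e"
      using that(4,6) by (auto simp: sim_cell_def)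
  qed
  have simple: ?thesis
    if "sim_data c b q b' i = Do j" "do_instr j (M, ys) = (M(sim_cell c b a := x), ys)"
      "exec w n H' [v] i \<sigma> = set_cell a x \<sigma>" "a < c" for j a x
    by (rule fin[of 1 "M(sim_cell c b a := x)"]) (use that in \<open>auto intro: runs.Do\<close>)
  have nop: ?thesis
    if "sim_data c b q b' i = Skip" "mem (exec w n H' [v] i \<sigma>) = mem \<sigma>"
      "out (exec w n H' [v] i \<sigma>) = out \<sigma>"
    using that st by (intro exI[of _ M]) (auto simp: sim_state_def intro: runs.Skip)
  show ?thesis
  proof (cases i)
    case (Load a d)
    then have in_range: "a < c" "d < c" "mem \<sigma> d < c" using touch by auto
    let ?N = "M(sim_cell c b a := mem \<sigma> (mem \<sigma> d))"
    have "\<exists>z'. runs (select (b + 2) (sim_cell c b d)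
        (\<lambda>x. Do (Copy (sim_cell c b a) (sim_cell c b x))) c 0) (M(b + 2 := M (b + 2)), ys)
        (3 * c + 1) (?N(b + 2 := z'), ys)"
    proof (rule runs_select)
      show "\<exists>z'. runs (Do (Copy (sim_cell c b a) (sim_cell c b (M (sim_cell c b d)))))
          (M(b + 2 := z), ys) 1 (?N(b + 2 := z'), ys)" for z
        using in_range cell ge by (intro exI[of _ z] runs_Do) (auto simp: fun_upd_twist)
    qed (use words in_range cell ge in auto)
    then obtain z' where "runs (sim_data c b q b' i) (M, ys) (3 * c + 1) (?N(b + 2 := z'), ys)"
      using Load by (auto simp only: sim_data.simps fun_upd_triv)
    then show ?thesis
      by (rule fin[where a = a and x = "mem \<sigma> (mem \<sigma> d)"]) (use Load in_range ge in auto)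
  next
    case (Store a d)
    then have in_range: "a < c" "d < c" "mem \<sigma> a < c" using touch by auto
    let ?N = "M(sim_cell c b (mem \<sigma> a) := mem \<sigma> d)"
    have "\<exists>z'. runs (select (b + 2) (sim_cell c b a)
        (\<lambda>x. Do (Copy (sim_cell c b x) (sim_cell c b d))) c 0) (M(b + 2 := M (b + 2)), ys)
        (3 * c + 1) (?N(b + 2 := z'), ys)"
    proof (rule runs_select)
      show "\<exists>z'. runs (Do (Copy (sim_cell c b (M (sim_cell c b a))) (sim_cell c b d)))
          (M(b + 2 := z), ys) 1 (?N(b + 2 := z'), ys)" for z
        using in_range cell ge by (intro exI[of _ z] runs_Do) (auto simp: fun_upd_twist)
    qed (use words in_range cell ge in auto)
    then obtain z' where "runs (sim_data c b q b' i) (M, ys) (3 * c + 1) (?N(b + 2 := z'), ys)"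
      using Store by (auto simp only: sim_data.simps fun_upd_triv)
    then show ?thesis
      by (rule fin[where a = "mem \<sigma> a" and x = "mem \<sigma> d"]) (use Store in_range ge in auto)
  next
    case (IsVert a d)
    then have in_range: "a < c" "d < c" using touch by auto
    obtain M' where M': "runs (sim_data c b q b' i) (M, ys) (B + 2) (M', ys)"
      "M' (sim_cell c b a) = of_bool (mem \<sigma> d \<in> verts H')"
      "\<forall>e\<ge>b. e \<noteq> sim_cell c b a \<longrightarrow> M' e = M e"
      using runs_vertex_query[OF q ge(1)[of a] ge(1)[of d], of M ys] cell[OF in_range(2)] IsVert
      by auto
    from M'(1) show ?thesis
      by (rule fin[where a = a and x = "of_bool (mem \<sigma> d \<in> verts H')"])
        (use M' IsVert in_range in auto)
  next
    case (IsEdge a d e)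
    then have in_range: "a < c" "d < c" "e < c" using touch by auto
    obtain M' where M': "runs (sim_data c b q b' i) (M, ys) (2 * B + 7) (M', ys)"
      "M' (sim_cell c b a) = of_bool ({mem \<sigma> d, mem \<sigma> e} \<in> edges H')"
      "\<forall>e\<ge>b. e \<noteq> sim_cell c b a \<longrightarrow> M' e = M e"
      using runs_edge_query[OF q ge(1)[of a] ge(1)[of d] ge(1)[of e], of M ys]
        cell[OF in_range(2)] cell[OF in_range(3)] IsEdge edges
      by auto
    from M'(1) show ?thesis
      by (rule fin[where a = a and x = "of_bool ({mem \<sigma> d, mem \<sigma> e} \<in> edges H')"])
        (use M' IsEdge in_range in auto)
  next
    case (Output a)
    then have "a < c" using touch by auto
    then show ?thesis
      using Output st
      by (intro exI[of _ "M(Suc b := mem \<sigma> a)"])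
        (auto intro!: runs.Do simp: cell sim_state_def sim_cell_def)
  next
    case (Const a x)
    then show ?thesis using touch by (intro simple) auto
  next
    case (Copy a d)
    then show ?thesis using touch cell by (intro simple) auto
  next
    case (Op f a d e)
    then show ?thesis using touch cell by (intro simple) auto
  next
    case (Arg a j)
    then show ?thesis using touch Mb
      by (intro simple[where a = a and x = "if j = 0 then v else 0"]) auto
  next
    case (NumV a)
    then show ?thesis using touch by (intro simple) auto
  qed (rule nop; simp)+
qed

lemma runs_sim_goto:
  assumes "sim_state c b v \<sigma> M" "pc \<sigma> = l" "1 \<le> w" "M (b + 3) = 1" "length p \<le> c"
    and "\<forall>l<length p. M (sim_flag c b l) = 0"
  shows "\<exists>M'. runs (sim_goto c b p l) (M, ys) 1 (M', ys) \<and> sim_rel c b v p \<sigma> M' \<and>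
    (\<forall>e\<ge>b + 2 * c + 5. M' e = M e)"
proof (cases "halted p \<sigma>")
  case True
  then show ?thesis using assms
    by (intro exI[of _ "M(b + 3 := 0)"] conjI)
      (auto simp: sim_goto_def sim_rel_def sim_state_def sim_cell_def halted_def intro!: runs.Do)
next
  case False
  have "(1::nat) mod 2 ^ w = 1" using assms(3) by simp
  then show ?thesis using assms False
    by (intro exI[of _ "M(sim_flag c b l := 1)"] conjI)
      (auto simp: sim_goto_def sim_rel_def sim_state_def sim_cell_def sim_flag_def halted_def
        intro!: runs.Do)
qed

text \<open>Branch tests are evaluated in the state after the instruction. This is sound because
  jumps do not change the memory.\<close>

lemma runs_sim_ctrl:
  assumes st: "sim_state c b v (exec w n H' [v] i \<sigma>) M"
    and "touched i (mem \<sigma>) \<subseteq> {..<c}" "i \<noteq> Halt"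
    and goto: "1 \<le> w" "M (b + 3) = 1" "length p \<le> c" "\<forall>l<length p. M (sim_flag c b l) = 0"
  shows "\<exists>M'. runs (sim_ctrl c b p (pc \<sigma>) i) (M, ys) 3 (M', ys) \<and>
    sim_rel c b v p (exec w n H' [v] i \<sigma>) M' \<and> (\<forall>e\<ge>b + 2 * c + 5. M' e = M e)"
proof -
  obtain M' where M': "runs (sim_goto c b p (pc (exec w n H' [v] i \<sigma>))) (M, ys) 1 (M', ys)"
    "sim_rel c b v p (exec w n H' [v] i \<sigma>) M'" "\<forall>e\<ge>b + 2 * c + 5. M' e = M e"
    using runs_sim_goto[OF st refl goto] by blast
  have "runs (sim_ctrl c b p (pc \<sigma>) i) (M, ys) 3 (M', ys)"
  proof (cases i)
    case (JumpZero a k)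
    then have "M (sim_cell c b a) = mem \<sigma> a" using assms(2) st by (auto simp: sim_state_def)
    then show ?thesis using JumpZero M'(1)
      by (cases "mem \<sigma> a = 0") (auto intro: runs.IfNz_True runs.IfNz_False)
  next
    case (JumpLess a d k)
    then have "M (sim_cell c b a) = mem \<sigma> a" "M (sim_cell c b d) = mem \<sigma> d"
      using assms(2) st by (auto simp: sim_state_def)
    then show ?thesis using JumpLess M'(1)
      by (cases "mem \<sigma> a < mem \<sigma> d") (auto intro: runs.IfLt_True runs.IfLt_False)
  qed (use M'(1) assms(3) in \<open>auto intro: runs_mono simp: set_cell_def\<close>)
  then show ?thesis using M' by blast
qed

lemma runs_sim_dispatch:
  assumes "\<forall>l\<in>set ls. M (sim_flag c b l) = of_bool (l = k)" "k \<in> set ls"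
    and "runs (Seq (sim_data c b q b' (p ! k)) (Seq (Do (Const (sim_flag c b k) 0))
      (sim_ctrl c b p k (p ! k)))) (M, ys) B s"
  shows "runs (sim_dispatch c b q b' p ls) (M, ys) (B + 2 * length ls) s"
  using assms(1,2)
proof (induction ls)
  case (Cons l ls)
  show ?case
  proof (cases "l = k")
    case True
    then show ?thesis using Cons.prems assms(3)
      by (auto intro: runs.IfNz_True)
  next
    case False
    then show ?thesis using Cons
      by (auto intro: runs.IfNz_False)
  qed
qed simp

text \<open>The cost is made up of \<open>2 * B + 3 * c + 7\<close> for the data part, one step for
  clearing the flag, at most three for control, and two for each of at most \<open>c\<close> flag
  tests.\<close>

lemma runs_sim_step:
  assumes q: "answers q b' b (verts H') B"
    and edges: "\<And>u v. {u, v} \<in> edges H' \<longleftrightarrow> u \<in> verts H' \<and> v \<in> verts H' \<and> {u, v} \<in> edges H"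
    and touch: "touched (p ! pc \<sigma>) (mem \<sigma>) \<subseteq> {..<c}"
    and words: "\<forall>a. mem \<sigma> a < 2 ^ w"
    and "1 \<le> w" "length p \<le> c" "\<not> halted p \<sigma>"
    and rel: "sim_rel c b v p \<sigma> M"
  shows "\<exists>M'. runs (sim_dispatch c b q b' p [0..<length p]) (M, ys) (2 * B + 5 * c + 11) (M', ys) \<and>
    sim_rel c b v p (step w n H' [v] p \<sigma>) M' \<and> (\<forall>e\<ge>b + 2 * c + 5. M' e = M e)"
proof -
  let ?l = "pc \<sigma>" and ?i = "p ! pc \<sigma>"
  let ?\<sigma> = "exec w n H' [v] ?i \<sigma>"
  have l: "?l < length p" "?i \<noteq> Halt" using assms(7) by (auto simp: halted_def)
  have st: "sim_state c b v \<sigma> M" and flags: "\<forall>l<length p. M (sim_flag c b l) = of_bool (l = ?l)"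
    and running: "M (b + 3) = 1"
    using rel assms(7) by (auto simp: sim_rel_def)
  obtain M1 where M1: "runs (sim_data c b q b' ?i) (M, ys) (2 * B + 3 * c + 7) (M1, ys)"
    "sim_state c b v ?\<sigma> M1" "\<forall>e. e = b + 3 \<or> b + 5 + c \<le> e \<longrightarrow> M1 e = M e"
    using runs_sim_data[OF q edges touch words st] by blast
  let ?M2 = "M1(sim_flag c b ?l := 0)"
  have "sim_state c b v ?\<sigma> ?M2"
    using M1(2) by (auto simp: sim_state_def sim_cell_def sim_flag_def)
  moreover have "?M2 (b + 3) = 1" using M1(3) running by (auto simp: sim_flag_def)
  moreover have "\<forall>l<length p. ?M2 (sim_flag c b l) = 0"
    using M1(3) flags by (auto simp: sim_flag_def)
  ultimately obtain M3 where M3: "runs (sim_ctrl c b p ?l ?i) (?M2, ys) 3 (M3, ys)"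
    "sim_rel c b v p ?\<sigma> M3" "\<forall>e\<ge>b + 2 * c + 5. M3 e = ?M2 e"
    using runs_sim_ctrl[OF _ touch l(2) assms(5) _ assms(6)] by blast
  have "runs (Seq (sim_data c b q b' ?i) (Seq (Do (Const (sim_flag c b ?l) 0))
      (sim_ctrl c b p ?l ?i))) (M, ys) (2 * B + 3 * c + 11) (M3, ys)"
    by (rule runs.Seq[OF M1(1) runs.Seq[OF runs_Do M3(1) order_refl]]) auto
  then have "runs (sim_dispatch c b q b' p [0..<length p]) (M, ys)
      (2 * B + 3 * c + 11 + 2 * length [0..<length p]) (M3, ys)"
    by (rule runs_sim_dispatch[rotated 2]) (use flags l in auto)
  then have "runs (sim_dispatch c b q b' p [0..<length p]) (M, ys) (2 * B + 5 * c + 11) (M3, ys)"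
    by (rule runs_mono) (use assms(6) in auto)
  moreover have "\<forall>e\<ge>b + 2 * c + 5. M3 e = M e"
    using M3(3) M1(3) l assms(6) by (auto simp: sim_flag_def)
  ultimately show ?thesis using M3(2) assms(7) by (auto simp: step_def)
qed

text \<open>The run starts in an arbitrary \<open>\<sigma>\<close> because the induction on
  \<open>T\<close> peels off its first step. The 13 is the 11 of one pass plus the two jumps of the
  loop.\<close>

lemma runs_sim_loop:
  assumes q: "answers q b' b (verts H') B"
    and edges: "\<And>u v. {u, v} \<in> edges H' \<longleftrightarrow> u \<in> verts H' \<and> v \<in> verts H' \<and> {u, v} \<in> edges H"
    and w: "1 \<le> w" and p: "length p \<le> c"
    and "\<And>j. j < T \<Longrightarrow> \<not> halted p ((step w n H' [v] p ^^ j) \<sigma>)"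
    and "\<And>j. j < T \<Longrightarrow> touched (p ! pc ((step w n H' [v] p ^^ j) \<sigma>))
      (mem ((step w n H' [v] p ^^ j) \<sigma>)) \<subseteq> {..<c}"
    and "\<And>j a. mem ((step w n H' [v] p ^^ j) \<sigma>) a < 2 ^ w"
    and "halted p ((step w n H' [v] p ^^ T) \<sigma>)"
    and "sim_rel c b v p \<sigma> M"
  shows "\<exists>M'. runs (WhileNz (b + 3) (sim_dispatch c b q b' p [0..<length p])) (M, ys)
      (T * (2 * B + 5 * c + 13) + 1) (M', ys) \<and>
    sim_rel c b v p ((step w n H' [v] p ^^ T) \<sigma>) M' \<and> (\<forall>e\<ge>b + 2 * c + 5. M' e = M e)"
  using assms(5-)
proof (induction T arbitrary: \<sigma> M)
  case 0
  then show ?case by (intro exI[of _ M]) (auto simp: sim_rel_def intro: runs.While_False)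
next
  case (Suc T)
  let ?\<sigma> = "step w n H' [v] p \<sigma>"
  have shift: "(step w n H' [v] p ^^ j) ?\<sigma> = (step w n H' [v] p ^^ Suc j) \<sigma>" for j
    by (simp add: funpow_swap1)
  have nh: "\<not> halted p \<sigma>" using Suc.prems(1)[of 0] by simp
  obtain M1 where M1: "runs (sim_dispatch c b q b' p [0..<length p]) (M, ys)
      (2 * B + 5 * c + 11) (M1, ys)"
    "sim_rel c b v p ?\<sigma> M1" "\<forall>e\<ge>b + 2 * c + 5. M1 e = M e"
    using runs_sim_step[OF q edges _ _ w p nh Suc.prems(5), of ys] Suc.prems(2)[of 0] Suc.prems(3)[of 0]
    by auto
  have "\<exists>M'. runs (WhileNz (b + 3) (sim_dispatch c b q b' p [0..<length p])) (M1, ys)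
      (T * (2 * B + 5 * c + 13) + 1) (M', ys) \<and>
    sim_rel c b v p ((step w n H' [v] p ^^ T) ?\<sigma>) M' \<and> (\<forall>e\<ge>b + 2 * c + 5. M' e = M1 e)"
  proof (rule Suc.IH)
    show "sim_rel c b v p ?\<sigma> M1" by (rule M1(2))
  next
    fix j assume "j < T"
    then show "\<not> halted p ((step w n H' [v] p ^^ j) ?\<sigma>)"
      "touched (p ! pc ((step w n H' [v] p ^^ j) ?\<sigma>)) (mem ((step w n H' [v] p ^^ j) ?\<sigma>)) \<subseteq> {..<c}"
      unfolding shift using Suc.prems(1,2)[of "Suc j"] by simp_all
  next
    show "mem ((step w n H' [v] p ^^ j) ?\<sigma>) a < 2 ^ w" for j a
      unfolding shift by (rule Suc.prems(3))
    show "halted p ((step w n H' [v] p ^^ T) ?\<sigma>)"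
      unfolding shift by (rule Suc.prems(4))
  qed
  then obtain M2 where M2: "runs (WhileNz (b + 3) (sim_dispatch c b q b' p [0..<length p])) (M1, ys)
      (T * (2 * B + 5 * c + 13) + 1) (M2, ys)"
    "sim_rel c b v p ((step w n H' [v] p ^^ T) ?\<sigma>) M2" "\<forall>e\<ge>b + 2 * c + 5. M2 e = M1 e"
    by blast
  have "M (b + 3) \<noteq> 0" using Suc.prems(5) nh by (simp add: sim_rel_def)
  then have "runs (WhileNz (b + 3) (sim_dispatch c b q b' p [0..<length p])) (M, ys)
      (Suc T * (2 * B + 5 * c + 13) + 1) (M2, ys)"
    by (intro runs.While_True[OF _ M1(1) M2(1)]) auto
  then show ?case using M1(3) M2(2,3) unfolding shift by auto
qed

text \<open>The time \<open>t\<close> of the interpreted program does not enter the bound; the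
  number of its configurations takes its place. Of the \<open>2 * c + 4\<close> extra steps,
  \<open>2 * c + 3\<close> are for the initialization and one for the final loop test.\<close>

lemma runs_sim:
  assumes q: "answers q b' b (verts H') B"
    and edges: "\<And>u v. {u, v} \<in> edges H' \<longleftrightarrow> u \<in> verts H' \<and> v \<in> verts H' \<and> {u, v} \<in> edges H"
    and w: "1 \<le> w" "n < 2 ^ w" "M b < 2 ^ w"
    and p: "length p \<le> c" and m: "m \<le> c"
    and comp: "computes w p n H' [M b] [y] t m"
  shows "\<exists>M'. runs (sim c b q b' p) (M, ys)
      (2 * c + 4 + c * (2 ^ w) ^ c * (2 * B + 5 * c + 13)) (M', ys) \<and>
    M' (Suc b) = y \<and> (\<forall>e\<ge>b + 2 * c + 5. M' e = M e)"
proof -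
  let ?v = "M b"
  let ?run = "\<lambda>j. (step w n H' [?v] p ^^ j) init_config"
  obtain T where T: "T \<le> length p * (2 ^ w) ^ m" "halted p (?run T)" "out (?run T) = [y]"
    "\<And>j. j < T \<Longrightarrow> \<not> halted p (?run j)"
    using halting_time_bound[OF comp w(2,1)] w(3) by auto
  have touch: "touched (p ! pc (?run j)) (mem (?run j)) \<subseteq> {..<c}" if "j < T" for j
    using comp T(4)[OF that] m by (force simp: computes_def)
  let ?xs = "Suc b # map (sim_cell c b) [0..<c] @ map (sim_flag c b) [0..<length p]"
  let ?M1 = "\<lambda>a. if a \<in> set ?xs then 0 else M a"
  let ?M2 = "?M1(b + 3 := 1)"
  have "sim_state c b ?v init_config ?M2"
    by (auto simp: sim_state_def init_config_def sim_cell_def sim_flag_def)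
  moreover have "\<forall>l<length p. ?M2 (sim_flag c b l) = 0"
    by (auto simp: sim_flag_def)
  ultimately obtain M3 where M3: "runs (sim_goto c b p 0) (?M2, ys) 1 (M3, ys)"
    "sim_rel c b ?v p init_config M3" "\<forall>e\<ge>b + 2 * c + 5. M3 e = ?M2 e"
    using runs_sim_goto[OF _ _ w(1) _ p, of b ?v init_config ?M2 0 ys]
    unfolding init_config_def by auto
  have "runs (sim_init c b p) (M, ys) (2 * c + 3) (M3, ys)"
    unfolding sim_init_def using p w(1)
    by (intro runs.Seq[OF runs_clear runs.Seq[OF runs_Do M3(1) order_refl]]) auto
  moreover obtain M4 where M4: "runs (WhileNz (b + 3) (sim_dispatch c b q b' p [0..<length p])) (M3, ys)
      (T * (2 * B + 5 * c + 13) + 1) (M4, ys)"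
    "sim_rel c b ?v p (?run T) M4" "\<forall>e\<ge>b + 2 * c + 5. M4 e = M3 e"
    using runs_sim_loop[OF q edges w(1) p T(4) touch _ T(2) M3(2), of ys] run_words[OF w(2,1)] w(3) by auto
  ultimately have "runs (sim c b q b' p) (M, ys) (2 * c + 3 + (T * (2 * B + 5 * c + 13) + 1)) (M4, ys)"
    unfolding sim_def by (auto intro: runs.Seq)
  moreover have "T * (2 * B + 5 * c + 13) \<le> c * (2 ^ w) ^ c * (2 * B + 5 * c + 13)"
  proof (rule mult_right_mono)
    have "length p * (2 ^ w) ^ m \<le> c * (2 ^ w) ^ c"
      using p m by (intro mult_mono power_increasing) auto
    then show "T \<le> c * (2 ^ w) ^ c" using T(1) by linarith
  qed simp
  ultimately have "runs (sim c b q b' p) (M, ys)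
      (2 * c + 4 + c * (2 ^ w) ^ c * (2 * B + 5 * c + 13)) (M4, ys)"
    by (auto elim: runs_mono)
  moreover have "M4 (Suc b) = y" using M4(2) T(3) by (simp add: sim_rel_def sim_state_def)
  moreover have "\<forall>e\<ge>b + 2 * c + 5. M4 e = M e"
    using M4(3) M3(3) p by (auto simp: sim_cell_def sim_flag_def)
  ultimately show ?thesis by blast
qed

end

section \<open>Memory used by the interpreter\<close>

lemma com_below_select:
  assumes "t < m" "y < m" "\<And>x. com_below m (f x)"
  shows "com_below m (select t y f k d)"
  using assms by (induction k arbitrary: d) auto

lemma com_below_clear: "(\<forall>a\<in>set xs. a < m) \<Longrightarrow> com_below m (clear xs)"
  by (induction xs) auto

lemma com_below_vertex_query:
  "com_below m q \<Longrightarrow> Suc b' < m \<Longrightarrow> a < m \<Longrightarrow> u < m \<Longrightarrow> com_below m (vertex_query q b' a u)"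
  by (simp add: vertex_query_def)

lemma com_below_edge_query:
  "com_below m q \<Longrightarrow> Suc b' < m \<Longrightarrow> a < m \<Longrightarrow> u < m \<Longrightarrow> v < m \<Longrightarrow>
    com_below m (edge_query q b' a u v)"
  by (simp add: edge_query_def)

lemma com_below_sim:
  assumes "com_below b q" "Suc b' < b" "length p \<le> c" "b + 2 * c + 5 \<le> m"
  shows "com_below m (sim c b q b' p)"
proof -
  have q: "com_below m q" by (rule com_below_mono[OF assms(1)]) (use assms in auto)
  have cell: "sim_cell c b a < m" for a using assms by (auto simp: sim_cell_def)
  have flag: "sim_flag c b l < m" if "l < length p" for l using assms that by (auto simp: sim_flag_def)
  have data: "com_below m (sim_data c b q b' i)" for i
    using assms q cell
    by (cases i) (auto intro!: com_below_select com_below_vertex_query com_below_edge_query)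
  have goto: "com_below m (sim_goto c b p l)" for l
    using assms flag by (auto simp: sim_goto_def)
  have ctrl: "com_below m (sim_ctrl c b p l i)" for l i
    using goto cell by (cases i) auto
  have dispatch: "com_below m (sim_dispatch c b q b' p ls)" if "\<forall>l\<in>set ls. l < length p" for ls
    using that data ctrl flag by (induction ls) auto
  show ?thesis
    unfolding sim_def sim_init_def
    using assms goto cell flag dispatch by (auto intro!: com_below_clear)
qed

section \<open>Queries to the layers\<close>

text \<open>The query \<open>q\<close> is the guard: the program \<open>p\<close> is known to halt
  only on vertices of the preceding layer, and all others get the answer 0. \<open>fin\<close> turns
  the truth value of the property into the answer wanted, by negation for survivors and by doing
  nothing for deleted vertices.\<close>

definition round_com :: "nat \<Rightarrow> nat \<Rightarrow> com \<Rightarrow> nat \<Rightarrow> program \<Rightarrow> com \<Rightarrow> com" where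
  "round_com c b q b' p fin = Seq (Do (Copy b' b)) (Seq q (IfNz (Suc b')
     (Seq (sim c b q b' p) fin) (Do (Const (Suc b) 0))))"

definition negate :: "nat \<Rightarrow> com" where
  "negate a = IfNz a (Do (Const a 0)) (Do (Const a 1))"

text \<open>A block has 4 administrative cells, \<open>c + 1\<close> cells of interpreted memory and
  at most \<open>c\<close> instruction flags.\<close>

definition base :: "nat \<Rightarrow> nat \<Rightarrow> nat" where
  "base c i = i * (2 * c + 5)"

text \<open>The command for one round is copied into every oracle instruction of the next, so the
  text may grow exponentially with the round. This is harmless: the round is fixed before the
  program is, and program text counts neither as time nor as space.\<close>

primrec layer_com :: "nat \<Rightarrow> (nat \<Rightarrow> program) \<Rightarrow> nat \<Rightarrow> com" where
  "layer_com c ps 0 = Do (IsVert 1 0)"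
| "layer_com c ps (Suc i) =
     round_com c (base c (Suc i)) (layer_com c ps i) (base c i) (ps (Suc i)) (negate (Suc (base c (Suc i))))"

definition deleted_com :: "nat \<Rightarrow> (nat \<Rightarrow> program) \<Rightarrow> nat \<Rightarrow> com" where
  "deleted_com c ps i =
     round_com c (base c i) (layer_com c ps (i - 1)) (base c (i - 1)) (ps i) Skip"

lemma base_Suc: "base c (Suc i) = base c i + 2 * c + 5"
  by (simp add: base_def)

lemma com_below_round_com:
  assumes "com_below b q" "Suc b' < b" "length p \<le> c" "b + 2 * c + 5 \<le> m" "com_below m fin"
  shows "com_below m (round_com c b q b' p fin)"
  using assms com_below_sim[OF assms(1-4)] com_below_mono[OF assms(1), of m]
  by (auto simp: round_com_def)

lemma com_below_layer_com:
  assumes "\<forall>j\<in>{1..i}. length (ps j) \<le> c"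
  shows "com_below (base c (Suc i)) (layer_com c ps i)"
  using assms
proof (induction i)
  case 0
  then show ?case by (simp add: base_def)
next
  case (Suc i)
  then have "com_below (base c (Suc i)) (layer_com c ps i)" by simp
  then show ?case unfolding layer_com.simps
    by (rule com_below_round_com) (use Suc.prems in \<open>auto simp: base_Suc negate_def\<close>)
qed

lemma com_below_deleted_com:
  assumes "\<forall>j\<in>{1..i}. length (ps j) \<le> c" "1 \<le> i"
  shows "com_below (base c (Suc i)) (deleted_com c ps i)"
proof -
  obtain k where k: "i = Suc k" using assms(2) by (cases i) auto
  show ?thesis unfolding deleted_com_def
    by (rule com_below_round_com) (use assms com_below_layer_com[of k] k in \<open>auto simp: base_Suc\<close>)
qed

definition round_factor :: "nat \<Rightarrow> nat \<Rightarrow> nat" where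
  "round_factor c w = 20 + 2 * c + c * (2 ^ w) ^ c * (15 + 5 * c)"

text \<open>As \<open>1 \<le> B\<close>, additive terms can be charged to \<open>B\<close>. One
  round thus multiplies the time by a fixed factor, and \<open>i\<close> rounds cost its
  \<open>i\<close>-th power.\<close>

lemma round_time:
  assumes "1 \<le> B"
  shows "B + 13 + 2 * c + c * (2 ^ w) ^ c * (2 * B + 5 * c + 13) \<le> round_factor c w * B"
proof -
  have "2 * B + 5 * c + 13 \<le> (15 + 5 * c) * B"
    using assms mult_le_mono2[OF assms, of "13 + 5 * c"] by (simp add: algebra_simps)
  then have "c * (2 ^ w) ^ c * (2 * B + 5 * c + 13) \<le> c * (2 ^ w) ^ c * (15 + 5 * c) * B"
    using mult_le_mono2 by (metis mult.assoc)
  moreover have "B + 13 + 2 * c \<le> (20 + 2 * c) * B"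
    using assms mult_le_mono2[OF assms, of "13 + 2 * c"] by (simp add: algebra_simps)
  ultimately show ?thesis unfolding round_factor_def
    by (simp only: distrib_right)
qed

text \<open>Deleting vertices yields induced subgraphs. Hence only vertex membership needs a
  recursion; edge queries reduce to it.\<close>

lemma layer_edges:
  assumes "simple_graph_on n G"
  shows "edges (layer P G i) = {e \<in> edges G. e \<subseteq> verts (layer P G i)}"
proof (induction i)
  case 0
  then show ?case using assms by (auto simp: simple_graph_on_def)
next
  case (Suc i)
  then show ?case by (auto simp: delete_verts_def)
qed

lemma layer_verts_subset: "verts (layer P G i) \<subseteq> verts G"
  by (induction i) (auto simp: delete_verts_def)

lemma verts_layer_Suc:
  "verts (layer P G (Suc i)) =
     {v \<in> verts (layer P G i). \<not> P (Suc i) (layer P G i) v}"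
  by (auto simp: delete_verts_def)

context machine
begin

text \<open>\<open>f\<close> is negation for survivors and the identity for deleted vertices. The
  answer of \<open>fin\<close> is prescribed only for contents 0 and 1, which are all that the
  interpreter leaves in the result cell.\<close>

lemma answers_round_com:
  assumes q: "answers q b' b (verts H') B"
    and edges: "\<And>u v. {u, v} \<in> edges H' \<longleftrightarrow> u \<in> verts H' \<and> v \<in> verts H' \<and> {u, v} \<in> edges H"
    and w: "1 \<le> w" "n < 2 ^ w" "verts H' \<subseteq> {..<2 ^ w}"
    and p: "length p \<le> c"
    and comp: "\<And>v. v \<in> verts H' \<Longrightarrow> \<exists>t m. computes w p n H' [v] [of_bool (Q v)] t m \<and> m \<le> c"
    and fin: "\<And>M ys. \<exists>M'. runs fin (M, ys) 3 (M', ys) \<and>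
      (\<forall>x. M (Suc b) = of_bool x \<longrightarrow> M' (Suc b) = of_bool (f x)) \<and> (\<forall>e\<ge>b + 2 * c + 5. M' e = M e)"
    and B: "1 \<le> B"
  shows "answers (round_com c b q b' p fin) b (b + 2 * c + 5) {v \<in> verts H'. f (Q v)} (round_factor c w * B)"
  unfolding answers_def
proof (intro conjI allI)
  fix M :: "nat \<Rightarrow> nat" and ys
  obtain M1 where M1: "runs q (M(b' := M b), ys) B (M1, ys)"
    "M1 (Suc b') = of_bool (M b \<in> verts H')" "\<forall>a\<ge>b. M1 a = (M(b' := M b)) a" and b: "Suc b' < b"
    using q unfolding answers_def by (metis fun_upd_same)
  have M1b: "M1 b = M b" using M1(3) b by simp
  let ?S = "2 * c + 4 + c * (2 ^ w) ^ c * (2 * B + 5 * c + 13)"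
  show "\<exists>M'. runs (round_com c b q b' p fin) (M, ys) (round_factor c w * B) (M', ys) \<and>
      M' (Suc b) = of_bool (M b \<in> {v \<in> verts H'. f (Q v)}) \<and> (\<forall>a\<ge>b + 2 * c + 5. M' a = M a)"
  proof (cases "M b \<in> verts H'")
    case True
    then obtain t m where "computes w p n H' [M1 b] [of_bool (Q (M b))] t m" "m \<le> c"
      using comp[OF True] unfolding M1b by blast
    moreover have "M1 b < 2 ^ w" using True w(3) M1b by auto
    ultimately obtain M2 where M2: "runs (sim c b q b' p) (M1, ys) ?S (M2, ys)"
      "M2 (Suc b) = of_bool (Q (M b))" "\<forall>e\<ge>b + 2 * c + 5. M2 e = M1 e"
      using runs_sim[OF q edges w(1,2) _ p, of M1] by blast
    obtain M3 where M3: "runs fin (M2, ys) 3 (M3, ys)" "M3 (Suc b) = of_bool (f (Q (M b)))"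
      "\<forall>e\<ge>b + 2 * c + 5. M3 e = M2 e"
      using fin[of M2 ys] M2(2) by blast
    have "runs (IfNz (Suc b') (Seq (sim c b q b' p) fin) (Do (Const (Suc b) 0))) (M1, ys) (?S + 5) (M3, ys)"
      using True M1(2) by (intro runs.IfNz_True[OF _ runs.Seq[OF M2(1) M3(1) order_refl]]) auto
    then have "runs (round_com c b q b' p fin) (M, ys) (B + ?S + 6) (M3, ys)"
      unfolding round_com_def by (intro runs.Seq[OF runs_Do runs.Seq[OF M1(1) _ order_refl]]) auto
    then have "runs (round_com c b q b' p fin) (M, ys) (round_factor c w * B) (M3, ys)"
      by (rule runs_mono) (use round_time[OF B, of c w] in linarith)
    then show ?thesis using True M3 M2 M1 b by (intro exI[of _ M3]) auto
  next
    case False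
    then have "runs (round_com c b q b' p fin) (M, ys) (B + 4) (M1(Suc b := 0), ys)"
      unfolding round_com_def using M1(2)
      by (intro runs.Seq[OF runs_Do runs.Seq[OF M1(1) runs.IfNz_False[OF _ runs_Do]]]) auto
    then have "runs (round_com c b q b' p fin) (M, ys) (round_factor c w * B) (M1(Suc b := 0), ys)"
      by (rule runs_mono) (use round_time[OF B, of c w] in linarith)
    then show ?thesis using False M1 b by (intro exI[of _ "M1(Suc b := 0)"]) auto
  qed
qed simp

lemma runs_negate:
  assumes "1 \<le> w"
  shows "runs (negate a) (M, ys) 3 (M(a := of_bool (M a = 0)), ys)"
  using assms unfolding negate_def
  by (cases "M a = 0") (auto intro: runs.IfNz_True[OF _ runs_Do] runs.IfNz_False[OF _ runs_Do])

lemma answers_layer_com: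
  assumes G: "simple_graph_on n H" and w: "1 \<le> w" "n < 2 ^ w"
    and ps: "\<forall>j\<in>{1..i}. length (ps j) \<le> c"
    and comp: "\<And>j v. j \<in> {1..i} \<Longrightarrow> v \<in> verts (layer P H (j - 1)) \<Longrightarrow>
      \<exists>t m. computes w (ps j) n (layer P H (j - 1)) [v] [of_bool (P j (layer P H (j - 1)) v)] t m \<and> m \<le> c"
  shows "answers (layer_com c ps i) (base c i) (base c (Suc i)) (verts (layer P H i)) (round_factor c w ^ i)"
    and "1 \<le> i \<Longrightarrow>
      answers (deleted_com c ps i) (base c i) (base c (Suc i)) (deleted P H i) (round_factor c w ^ i)"
proof -
  have edges: "{u, v} \<in> edges (layer P H j) \<longleftrightarrow>
      u \<in> verts (layer P H j) \<and> v \<in> verts (layer P H j) \<and> {u, v} \<in> edges H" for u v j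
    using layer_edges[OF G, of P j] by auto
  have small: "verts (layer P H j) \<subseteq> {..<2 ^ w}" for j
    using layer_verts_subset[of P H j] G w by (auto simp: simple_graph_on_def)
  have pos: "1 \<le> round_factor c w ^ j" for j
    by (simp add: round_factor_def)
  have layers: "answers (layer_com c ps j) (base c j) (base c (Suc j)) (verts (layer P H j))
      (round_factor c w ^ j)" if "j \<le> i" for j
    using that
  proof (induction j)
    case 0
    \<comment> \<open>Block 0 starts at address 0, with the argument in cell 0 and the answer in
      cell 1. The single step matches \<open>round_factor c w ^ 0\<close>.\<close>
    have "runs (Do (IsVert 1 0)) (M, ys) 1 (M(1 := of_bool (M 0 \<in> verts H)), ys)" for M ys
      by (rule runs_Do) simp
    then show ?case unfolding answers_def
      by (auto simp: base_def intro!: exI[of _ "_(Suc 0 := _)"])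
  next
    case (Suc j)
    have "answers (layer_com c ps (Suc j)) (base c (Suc j)) (base c (Suc j) + 2 * c + 5)
        {v \<in> verts (layer P H j). \<not> P (Suc j) (layer P H j) v}
        (round_factor c w * round_factor c w ^ j)"
      unfolding layer_com.simps
    proof (rule answers_round_com[where f = Not and Q = "P (Suc j) (layer P H j)"])
      show "answers (layer_com c ps j) (base c j) (base c (Suc j)) (verts (layer P H j))
          (round_factor c w ^ j)"
        using Suc by simp
      fix v assume "v \<in> verts (layer P H j)"
      then show "\<exists>t m. computes w (ps (Suc j)) n (layer P H j) [v]
          [of_bool (P (Suc j) (layer P H j) v)] t m \<and> m \<le> c"
        using comp[of "Suc j" v] Suc.prems by simp
    next
      fix M :: "nat \<Rightarrow> nat" and ys
      let ?a = "Suc (base c (Suc j))"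
      show "\<exists>M'. runs (negate ?a) (M, ys) 3 (M', ys) \<and>
          (\<forall>x. M ?a = of_bool x \<longrightarrow> M' ?a = of_bool (\<not> x)) \<and>
          (\<forall>e\<ge>base c (Suc j) + 2 * c + 5. M' e = M e)"
        using runs_negate[OF w(1)] by (intro exI[of _ "M(?a := of_bool (M ?a = 0))"]) auto
    qed (use edges small w ps pos Suc.prems in auto)
    then show ?case unfolding verts_layer_Suc by (simp add: base_Suc)
  qed
  then show "answers (layer_com c ps i) (base c i) (base c (Suc i)) (verts (layer P H i))
      (round_factor c w ^ i)" by simp
  show "answers (deleted_com c ps i) (base c i) (base c (Suc i)) (deleted P H i) (round_factor c w ^ i)"
    if i: "1 \<le> i"
  proof -
    obtain k where k: "i = Suc k" using i by (cases i) auto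
    have "answers (deleted_com c ps i) (base c i) (base c i + 2 * c + 5)
        {v \<in> verts (layer P H k). P i (layer P H k) v} (round_factor c w * round_factor c w ^ k)"
      unfolding deleted_com_def k diff_Suc_1
    proof (rule answers_round_com[where f = "\<lambda>x. x" and Q = "P (Suc k) (layer P H k)"])
      show "answers (layer_com c ps k) (base c k) (base c (Suc k)) (verts (layer P H k))
          (round_factor c w ^ k)"
        using layers k by simp
      fix v assume "v \<in> verts (layer P H k)"
      then show "\<exists>t m. computes w (ps (Suc k)) n (layer P H k) [v]
          [of_bool (P (Suc k) (layer P H k) v)] t m \<and> m \<le> c"
        using comp[of "Suc k" v] k by simp
    next
      fix M :: "nat \<Rightarrow> nat" and ys
      show "\<exists>M'. runs Skip (M, ys) 3 (M', ys) \<and>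
          (\<forall>x. M (Suc (base c (Suc k))) = of_bool x \<longrightarrow> M' (Suc (base c (Suc k))) = of_bool x) \<and>
          (\<forall>e\<ge>base c (Suc k) + 2 * c + 5. M' e = M e)"
        by (intro exI[of _ M]) (auto intro: runs.Skip)
    qed (use edges small w ps pos k in auto)
    then show ?thesis using k by (simp add: base_Suc deleted_def)
  qed
qed

end

section \<open>Enumeration\<close>

text \<open>\<open>WhileNz\<close> can test a falling counter directly, and decrementing before the
  body makes a counter started at \<open>n\<close> run through exactly the vertices. The constant 1
  is reloaded in each pass because the body may use \<open>t\<close> as scratch.\<close>

definition countdown :: "nat \<Rightarrow> nat \<Rightarrow> com \<Rightarrow> com" where
  "countdown a t body = WhileNz a (Seq (Do (Const t 1)) (Seq (Do (Op Sub a a t)) body))"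

definition member_com :: "com \<Rightarrow> nat \<Rightarrow> com" where
  "member_com q b' = Seq (Do (Arg b' 0)) (Seq q (Do (Output (Suc b'))))"

definition enum_com :: "com \<Rightarrow> nat \<Rightarrow> nat \<Rightarrow> com" where
  "enum_com q b' b = Seq (Do (NumV b)) (countdown b (b + 1)
     (Seq (vertex_query q b' (b + 1) b) (IfNz (b + 1) (Do (Output b)) Skip)))"

definition edge_member_com :: "com \<Rightarrow> nat \<Rightarrow> nat \<Rightarrow> com" where
  "edge_member_com q b' b = Seq (Do (Arg b 0)) (Seq (Do (Arg (b + 1) 1))
     (Seq (edge_query q b' (b + 2) b (b + 1)) (Do (Output (b + 2)))))"

text \<open>The inner counter starts from the outer one, so only pairs with a smaller second
  component are visited and no edge is met twice.\<close>

definition edge_enum_com :: "com \<Rightarrow> nat \<Rightarrow> nat \<Rightarrow> com" where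
  "edge_enum_com q b' b = Seq (Do (NumV b)) (countdown b (b + 1)
     (Seq (Do (Copy (b + 2) b)) (countdown (b + 2) (b + 1)
       (Seq (edge_query q b' (b + 1) b (b + 2))
         (IfNz (b + 1) (Seq (Do (Output b)) (Do (Output (b + 2)))) Skip)))))"

lemma com_below_top:
  assumes "com_below b q" "Suc b' < b"
  shows "com_below (b + 3) (member_com q b')" "com_below (b + 3) (enum_com q b' b)"
    "com_below (b + 3) (edge_member_com q b' b)" "com_below (b + 3) (edge_enum_com q b' b)"
  using assms com_below_mono[OF assms(1), of "b + 3"]
  by (auto simp: member_com_def enum_com_def edge_member_com_def edge_enum_com_def countdown_def
      intro!: com_below_vertex_query com_below_edge_query)

context machine
begin

text \<open>The invariant \<open>I\<close> must survive any change of the cells \<open>a\<close> and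
  \<open>t\<close>, which every pass overwrites. The 4 consists of two jumps, the constant and the
  subtraction. Output appears in falling order, hence \<open>rev\<close>.\<close>

lemma runs_countdown:
  assumes w: "1 \<le> w" and "a \<noteq> t" "M a = k" "k < 2 ^ w" "I M"
    and D: "B + 4 \<le> D"
    and I: "\<And>M x y. I M \<Longrightarrow> I (M(t := x, a := y))"
    and body: "\<And>v M ys. v < k \<Longrightarrow> M a = v \<Longrightarrow> I M \<Longrightarrow>
      \<exists>M'. runs body (M, ys) B (M', ys @ f v) \<and> M' a = v \<and> I M'"
  shows "\<exists>M'. runs (countdown a t body) (M, ys) (k * D + 1)
    (M', ys @ concat (map f (rev [0..<k]))) \<and> I M'"
  using assms(3-5) body
proof (induction k arbitrary: M ys)
  case 0
  then show ?case unfolding countdown_def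
    by (intro exI[of _ M]) (auto intro: runs.While_False)
next
  case (Suc k)
  let ?M = "M(t := 1, a := k)"
  have "int k < int (2 ^ w)" using Suc.prems(2) unfolding of_nat_less_iff by simp
  then have "int k mod 2 ^ w = int k" by simp
  then have sub: "binop_val w Sub (Suc k) 1 = k" by simp
  have "?M a = k" by simp
  from Suc.prems(4)[OF lessI this I[OF Suc.prems(3)]]
  obtain M1 where M1: "runs body (?M, ys) B (M1, ys @ f k)" "M1 a = k" "I M1" by blast
  have "\<exists>M'. runs (countdown a t body) (M1, ys @ f k) (k * D + 1)
      (M', (ys @ f k) @ concat (map f (rev [0..<k]))) \<and> I M'"
  proof (rule Suc.IH[OF M1(2) _ M1(3)])
    fix v ys and M :: "nat \<Rightarrow> nat" assume "v < k" "M a = v" "I M"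
    then show "\<exists>M'. runs body (M, ys) B (M', ys @ f v) \<and> M' a = v \<and> I M'"
      by (intro Suc.prems(4)) auto
  qed (use Suc.prems(2) in simp)
  then obtain M2 where M2: "runs (countdown a t body) (M1, ys @ f k) (k * D + 1)
      (M2, (ys @ f k) @ concat (map f (rev [0..<k])))" "I M2"
    by blast
  have iter: "runs (Seq (Do (Const t 1)) (Seq (Do (Op Sub a a t)) body)) (M, ys) (B + 2) (M1, ys @ f k)"
    by (rule runs.Seq[OF runs_Do runs.Seq[OF runs_Do M1(1) order_refl]])
      (use sub w assms(2) Suc.prems(1) in auto)
  have "runs (countdown a t body) (M, ys) (Suc k * D + 1)
      (M2, (ys @ f k) @ concat (map f (rev [0..<k])))"
    unfolding countdown_def
    by (rule runs.While_True[OF _ iter M2(1)[unfolded countdown_def]]) (use Suc.prems(1) D in auto)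
  then show ?case using M2(2) by auto
qed

lemma runs_member_com:
  assumes "answers q b' b X B"
  shows "\<exists>M. runs (member_com q b') (\<lambda>_. 0, []) (B + 2)
    (M, [of_bool ((if 0 < length args then args ! 0 else 0) \<in> X)])"
proof -
  let ?M = "(\<lambda>_. 0)(b' := if 0 < length args then args ! 0 else 0)"
  obtain M where M: "runs q (?M, []) B (M, [])" "M (Suc b') = of_bool (?M b' \<in> X)"
    using assms unfolding answers_def by blast
  have "runs (member_com q b') (\<lambda>_. 0, []) (B + 2) (M, [of_bool (?M b' \<in> X)])"
    unfolding member_com_def
    by (rule runs.Seq[OF runs_Do runs.Seq[OF M(1) runs_Do order_refl]]) (use M(2) in auto)
  then show ?thesis by auto
qed

lemma runs_enum_com:
  assumes q: "answers q b' b X B" and w: "1 \<le> w" "n < 2 ^ w"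
  shows "\<exists>M. runs (enum_com q b' b) (\<lambda>_. 0, []) (n * (B + 9) + 2) (M, filter (\<lambda>v. v \<in> X) (rev [0..<n]))"
proof -
  let ?f = "\<lambda>v. if v \<in> X then [v] else []"
  have "\<exists>M. runs (countdown b (b + 1) (Seq (vertex_query q b' (b + 1) b) (IfNz (b + 1) (Do (Output b)) Skip)))
      ((\<lambda>_. 0)(b := n), []) (n * (B + 9) + 1) (M, [] @ concat (map ?f (rev [0..<n]))) \<and> True"
  proof (rule runs_countdown[where B = "B + 5"])
    fix v ys and M :: "nat \<Rightarrow> nat" assume v: "M b = v"
    obtain M1 where M1: "runs (vertex_query q b' (b + 1) b) (M, ys) (B + 2) (M1, ys)"
      "M1 (b + 1) = of_bool (v \<in> X)" "\<forall>e\<ge>b. e \<noteq> b + 1 \<longrightarrow> M1 e = M e"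
      using runs_vertex_query[OF q, of "b + 1" b M ys] v by auto
    have "runs (IfNz (b + 1) (Do (Output b)) Skip) (M1, ys) 3 (M1, ys @ ?f v)"
      using M1(2,3) v
      by (cases "v \<in> X") (auto intro!: runs.IfNz_True[OF _ runs_Do] runs.IfNz_False[OF _ runs.Skip[of _ 1]])
    then have "runs (Seq (vertex_query q b' (b + 1) b) (IfNz (b + 1) (Do (Output b)) Skip))
        (M, ys) (B + 5) (M1, ys @ ?f v)"
      by (rule runs.Seq[OF M1(1)]) simp
    then show "\<exists>M'. runs (Seq (vertex_query q b' (b + 1) b) (IfNz (b + 1) (Do (Output b)) Skip))
        (M, ys) (B + 5) (M', ys @ ?f v) \<and> M' b = v \<and> True"
      using M1(3) v by (intro exI[of _ M1]) simp
  qed (use w in auto)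
  then obtain M where M: "runs (countdown b (b + 1) (Seq (vertex_query q b' (b + 1) b)
      (IfNz (b + 1) (Do (Output b)) Skip)))
      ((\<lambda>_. 0)(b := n), []) (n * (B + 9) + 1) (M, concat (map ?f (rev [0..<n])))"
    unfolding append_Nil by blast
  have eq: "concat (map ?f xs) = filter (\<lambda>v. v \<in> X) xs" for xs
    by (induction xs) auto
  have "runs (enum_com q b' b) (\<lambda>_. 0, []) (n * (B + 9) + 2) (M, filter (\<lambda>v. v \<in> X) (rev [0..<n]))"
    unfolding enum_com_def by (rule runs.Seq[OF runs_Do M[unfolded eq]]) auto
  then show ?thesis by blast
qed

lemma runs_edge_member_com:
  assumes q: "answers q b' b X B" and args: "args = [u, v]"
  shows "\<exists>M. runs (edge_member_com q b' b) (\<lambda>_. 0, []) (2 * B + 10)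
    (M, [of_bool (u \<in> X \<and> v \<in> X \<and> {u, v} \<in> edges H)])"
proof -
  have args_nth: "length args = 2" "args ! 0 = u" "args ! Suc 0 = v" by (simp_all add: args)
  let ?M = "(\<lambda>_. 0)(b := u, b + 1 := v)"
  obtain M where M: "runs (edge_query q b' (b + 2) b (b + 1)) (?M, []) (2 * B + 7) (M, [])"
    "M (b + 2) = of_bool (u \<in> X \<and> v \<in> X \<and> {u, v} \<in> edges H)"
    using runs_edge_query[OF q, of "b + 2" b "b + 1" ?M "[]"] by auto
  have "runs (edge_member_com q b' b) (\<lambda>_. 0, []) (2 * B + 10)
    (M, [of_bool (u \<in> X \<and> v \<in> X \<and> {u, v} \<in> edges H)])"
    unfolding edge_member_com_def
    by (rule runs.Seq[OF runs_Do runs.Seq[OF runs_Do runs.Seq[OF M(1) runs_Do order_refl] order_refl]])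
      (use M(2) args_nth in auto)
  then show ?thesis by blast
qed

text \<open>The 15 collects 7 of the edge query, 4 of the conditional output and 4 of the inner
  loop. The 6 collects the copied counter, the last test of the inner loop and 4 of the outer
  loop.\<close>

lemma runs_edge_enum_com:
  assumes q: "answers q b' b X B" and w: "1 \<le> w" "n < 2 ^ w"
  shows "\<exists>M. runs (edge_enum_com q b' b) (\<lambda>_. 0, []) (n * (n * (2 * B + 15) + 6) + 2)
    (M, concat (map (\<lambda>u. concat (map (\<lambda>v.
      if u \<in> X \<and> v \<in> X \<and> {u, v} \<in> edges H then [u, v] else []) (rev [0..<u]))) (rev [0..<n])))"
proof -
  let ?g = "\<lambda>u v. if u \<in> X \<and> v \<in> X \<and> {u, v} \<in> edges H then [u, v] else []"
  let ?f = "\<lambda>u. concat (map (?g u) (rev [0..<u]))"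
  let ?inner = "Seq (edge_query q b' (b + 1) b (b + 2))
    (IfNz (b + 1) (Seq (Do (Output b)) (Do (Output (b + 2)))) Skip)"
  let ?outer = "Seq (Do (Copy (b + 2) b)) (countdown (b + 2) (b + 1) ?inner)"
  have "\<exists>M. runs (countdown b (b + 1) ?outer) ((\<lambda>_. 0)(b := n), [])
      (n * (n * (2 * B + 15) + 6) + 1) (M, [] @ concat (map ?f (rev [0..<n]))) \<and> True"
  proof (rule runs_countdown[where B = "n * (2 * B + 15) + 2"])
    fix u ys and M :: "nat \<Rightarrow> nat" assume u: "u < n" "M b = u"
    let ?M = "M(b + 2 := u)"
    have "\<exists>M'. runs (countdown (b + 2) (b + 1) ?inner) (?M, ys)
        (u * (2 * B + 15) + 1) (M', ys @ concat (map (?g u) (rev [0..<u]))) \<and> M' b = u"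
    proof (rule runs_countdown[where B = "2 * B + 11"])
      fix v ys and M :: "nat \<Rightarrow> nat" assume v: "M (b + 2) = v" "M b = u"
      obtain M1 where M1: "runs (edge_query q b' (b + 1) b (b + 2)) (M, ys) (2 * B + 7) (M1, ys)"
        "M1 (b + 1) = of_bool (u \<in> X \<and> v \<in> X \<and> {u, v} \<in> edges H)"
        "\<forall>e\<ge>b. e \<noteq> b + 1 \<longrightarrow> M1 e = M e"
        using runs_edge_query[OF q, of "b + 1" b "b + 2" M ys] v by auto
      have M1b: "M1 b = u" "M1 (b + 2) = v" using M1(3) v by auto
      have "runs (IfNz (b + 1) (Seq (Do (Output b)) (Do (Output (b + 2)))) Skip) (M1, ys) 4
          (M1, ys @ ?g u v)"
      proof (cases "u \<in> X \<and> v \<in> X \<and> {u, v} \<in> edges H")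
        case True
        then show ?thesis using M1(2) M1b
          by (intro runs.IfNz_True[OF _ runs.Seq[OF runs_Do runs_Do order_refl]]) auto
      next
        case False
        then have "runs (IfNz (b + 1) (Seq (Do (Output b)) (Do (Output (b + 2)))) Skip) (M1, ys) 4 (M1, ys)"
          using M1(2) by (intro runs.IfNz_False[OF _ runs.Skip[of _ 2]]) auto
        then show ?thesis using False by auto
      qed
      then have "runs ?inner (M, ys) (2 * B + 11) (M1, ys @ ?g u v)"
        by (rule runs.Seq[OF M1(1)]) simp
      then show "\<exists>M'. runs ?inner (M, ys) (2 * B + 11) (M', ys @ ?g u v) \<and> M' (b + 2) = v \<and> M' b = u"
        using M1b by blast
    qed (use w u in auto)
    then obtain M1 where M1: "runs (countdown (b + 2) (b + 1) ?inner) (?M, ys)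
        (u * (2 * B + 15) + 1) (M1, ys @ ?f u)" "M1 b = u"
      unfolding append_Nil by blast
    have "u * (2 * B + 15) \<le> n * (2 * B + 15)" using u(1) by (intro mult_right_mono) auto
    then have "runs ?outer (M, ys) (n * (2 * B + 15) + 2) (M1, ys @ ?f u)"
      by (intro runs.Seq[OF runs_Do M1(1)]) (use u in auto)
    then show "\<exists>M'. runs ?outer (M, ys) (n * (2 * B + 15) + 2) (M', ys @ ?f u) \<and> M' b = u \<and> True"
      using M1(2) by blast
  qed (use w in auto)
  then obtain M where M: "runs (countdown b (b + 1) ?outer) ((\<lambda>_. 0)(b := n), [])
      (n * (n * (2 * B + 15) + 6) + 1) (M, concat (map ?f (rev [0..<n])))"
    unfolding append_Nil by blast
  have "runs (edge_enum_com q b' b) (\<lambda>_. 0, []) (n * (n * (2 * B + 15) + 6) + 2)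
      (M, concat (map ?f (rev [0..<n])))"
    unfolding edge_enum_com_def by (rule runs.Seq[OF runs_Do M]) auto
  then show ?thesis by blast
qed

end

section \<open>Arithmetic of word length, time and edge lists\<close>

text \<open>The lower bound by \<open>log 2 n\<close> converts bits into at most \<open>c\<close>
  words; the upper bounds make the number of word values polynomial. The exponent 3 comes from
  \<open>2 ^ L \<le> 4 * n \<le> n ^ 3\<close>, which needs no additive constant from
  \<open>n = 2\<close> on.\<close>

lemma word_length_bounds:
  assumes "2 \<le> n" "1 \<le> \<kappa>"
  shows "1 \<le> word_length \<kappa> n" "n < 2 ^ word_length \<kappa> n" "2 ^ word_length \<kappa> n \<le> n ^ (3 * \<kappa>)"
    "real (word_length \<kappa> n) \<le> real (3 * \<kappa>) * log 2 (real n)" "log 2 (real n) \<le> real (word_length \<kappa> n)"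
proof -
  define L where "L = nat \<lceil>log 2 (real n + 1)\<rceil>"
  have wl: "word_length \<kappa> n = \<kappa> * L" by (simp add: word_length_def L_def)
  have "0 \<le> log 2 (real n + 1)" by simp
  then have "real L = of_int \<lceil>log 2 (real n + 1)\<rceil>" by (simp add: L_def)
  then have L: "log 2 (real n + 1) \<le> real L" "real L \<le> log 2 (real n + 1) + 1"
    by linarith+
  have "real n + 1 \<le> 2 powr real L" using L(1) by (simp add: log_le_iff)
  also have "\<dots> = real (2 ^ L)" by (simp add: powr_realpow)
  finally have n_L: "n < 2 ^ L" by linarith
  have "real (2 ^ L) = 2 powr real L" by (simp add: powr_realpow)
  also have "\<dots> \<le> 2 powr (log 2 (real n + 1) + 1)" using L(2) by (intro powr_mono) auto
  also have "\<dots> = 2 * (real n + 1)" by (simp add: powr_add)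
  also have "\<dots> = real (2 * (n + 1))" by simp
  finally have "2 ^ L \<le> 2 * (n + 1)" unfolding of_nat_le_iff .
  also have "\<dots> \<le> 4 * n" using assms(1) by simp
  also have "\<dots> \<le> n * n * n" using mult_le_mono[OF assms(1) assms(1)] by (intro mult_right_mono) auto
  finally have L_n: "2 ^ L \<le> n ^ 3" by (simp add: power3_eq_cube)
  have "L \<noteq> 0" using n_L assms(1) by (cases L) auto
  then show "1 \<le> word_length \<kappa> n" using wl assms(2) by (simp add: Suc_le_eq)
  have L_le: "L \<le> \<kappa> * L" using assms(2) by simp
  then have "(2::nat) ^ L \<le> 2 ^ (\<kappa> * L)" by simp
  then show "n < 2 ^ word_length \<kappa> n" using n_L unfolding wl by (rule less_le_trans[rotated])
  have "(2::nat) ^ word_length \<kappa> n = (2 ^ L) ^ \<kappa>" by (simp add: wl power_mult mult.commute)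
  also have "\<dots> \<le> (n ^ 3) ^ \<kappa>" using L_n by (rule power_mono) simp
  finally show "2 ^ word_length \<kappa> n \<le> n ^ (3 * \<kappa>)" by (simp add: power_mult)
  have "real (2 ^ L) \<le> real (n ^ 3)" using L_n of_nat_le_iff by blast
  then have "log 2 (real (2 ^ L)) \<le> log 2 (real (n ^ 3))"
    by (intro log_mono) auto
  then have "real L \<le> 3 * log 2 (real n)" using assms(1) by (simp add: log_nat_power)
  then show "real (word_length \<kappa> n) \<le> real (3 * \<kappa>) * log 2 (real n)"
    unfolding wl using mult_left_mono[of "real L" "3 * log 2 (real n)" "real \<kappa>"] by (simp add: algebra_simps)
  have "log 2 (real n) \<le> log 2 (real n + 1)" using assms(1) by simp
  also have "\<dots> \<le> real L" by (rule L(1))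
  also have "\<dots> \<le> real (word_length \<kappa> n)" unfolding wl using L_le of_nat_le_iff by blast
  finally show "log 2 (real n) \<le> real (word_length \<kappa> n)" .
qed

text \<open>The coefficients of \<open>round_factor\<close> become exponents by
  \<open>a \<le> n ^ a\<close>, and \<open>3 * \<kappa> * c\<close> accounts for
  \<open>(2 ^ w) ^ c\<close>. The 7 pays for the loop over pairs: two factors \<open>n\<close> and a
  constant \<open>24 \<le> n ^ 5\<close>.\<close>

definition time_exponent :: "nat \<Rightarrow> nat \<Rightarrow> nat" where
  "time_exponent \<kappa> c = 20 + 2 * c + c * (15 + 5 * c) + 3 * \<kappa> * c + 7"

lemma total_time:
  assumes n: "2 \<le> n" and i: "1 \<le> i" and w: "2 ^ w \<le> n ^ (3 * \<kappa>)"
  shows "n * (n * (2 * round_factor c w ^ i + 15) + 6) + 2 \<le> n ^ (time_exponent \<kappa> c * i)"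
proof -
  define A where "A = 20 + 2 * c + c * (15 + 5 * c)"
  have pow2: "a \<le> n ^ a" for a
  proof -
    have "a \<le> 2 ^ a" using less_exp[of a] by simp
    also have "\<dots> \<le> n ^ a" using n by (rule power_mono) simp
    finally show ?thesis .
  qed
  define W where "W = n ^ (3 * \<kappa> * c)"
  have W1: "1 \<le> W" using n by (simp add: W_def)
  have "(2 ^ w) ^ c \<le> (n ^ (3 * \<kappa>)) ^ c" using w by (rule power_mono) simp
  then have wc: "(2 ^ w) ^ c \<le> W" by (simp add: W_def power_mult)
  have "round_factor c w \<le> (20 + 2 * c) * W + c * W * (15 + 5 * c)"
    unfolding round_factor_def
    using mult_le_mono2[OF W1, of "20 + 2 * c"] wc by (intro add_mono mult_mono) auto
  also have "\<dots> = A * W" by (simp add: A_def algebra_simps)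
  also have "\<dots> \<le> n ^ A * W" using pow2 by (rule mult_right_mono) simp
  also have "\<dots> = n ^ (A + 3 * \<kappa> * c)" by (simp add: W_def power_add)
  finally have "round_factor c w ^ i \<le> (n ^ (A + 3 * \<kappa> * c)) ^ i" by (rule power_mono) simp
  then have B: "round_factor c w ^ i \<le> n ^ ((A + 3 * \<kappa> * c) * i)" by (simp add: power_mult)
  define B where "B = round_factor c w ^ i"
  have B1: "1 \<le> B" by (simp add: B_def round_factor_def)
  have n2: "4 \<le> n * n" using mult_le_mono[OF n n] by simp
  have "n * (n * (2 * B + 15) + 6) + 2 \<le> n * n * (17 * B) + n * n * (6 * B) + n * n * B"
  proof -
    have "n * n * (2 * B + 15) \<le> n * n * (17 * B)" using B1 by (intro mult_left_mono) auto
    moreover have "n * 6 \<le> n * n * (6 * B)"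
      using mult_le_mono[of n "n * n" 6 "6 * B"] n B1 by simp
    moreover have "2 \<le> n * n * B" using mult_le_mono[OF n2 B1] by simp
    ultimately have "n * n * (2 * B + 15) + n * 6 + 2 \<le> n * n * (17 * B) + n * n * (6 * B) + n * n * B"
      by (intro add_mono)
    then show ?thesis by (simp only: distrib_left mult.assoc)
  qed
  also have "\<dots> = 24 * (n * n * B)" by simp
  also have "\<dots> \<le> n ^ 5 * (n * n * B)"
  proof (rule mult_right_mono)
    have "(2::nat) ^ 5 \<le> n ^ 5" using n by (rule power_mono) simp
    then show "24 \<le> n ^ 5" by simp
  qed simp
  also have "\<dots> = n ^ 7 * B" by (simp add: eval_nat_numeral)
  \<comment> \<open>The enumeration overhead occurs once, but charging it to every round makes the
    exponent a multiple of \<open>i\<close>.\<close>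
  also have "\<dots> \<le> n ^ (7 * i) * n ^ ((A + 3 * \<kappa> * c) * i)"
    using B n i unfolding B_def by (intro mult_mono power_increasing) auto
  also have "\<dots> = n ^ (time_exponent \<kappa> c * i)"
    unfolding power_add[symmetric] by (simp add: time_exponent_def A_def algebra_simps)
  finally show ?thesis by (simp add: B_def)
qed

text \<open>This links the flat stream of the nested loops to the list of pairs demanded by the
  specification. Distinctness holds because every set in the block of \<open>n\<close> contains
  \<open>n\<close>, while all sets from \<open>es n\<close> consist of smaller numbers.\<close>

lemma edge_list:
  fixes Q :: "nat \<Rightarrow> nat \<Rightarrow> bool"
  defines "es \<equiv> \<lambda>n. concat (map (\<lambda>u. map (Pair u) (filter (Q u) (rev [0..<u]))) (rev [0..<n]))"
  shows "concat (map (\<lambda>u. concat (map (\<lambda>v. if Q u v then [u, v] else []) (rev [0..<u]))) (rev [0..<n])) =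
      concat (map (\<lambda>(u, v). [u, v]) (es n))"
    and "distinct (map (\<lambda>(u, v). {u, v}) (es n))"
    and "set (map (\<lambda>(u, v). {u, v}) (es n)) = {{u, v} | u v. v < u \<and> u < n \<and> Q u v}"
proof -
  have es_Suc: "es (Suc n) = map (Pair n) (filter (Q n) (rev [0..<n])) @ es n" for n
    by (simp add: es_def)
  have block: "concat (map (\<lambda>(u, v). [u, v]) (map (Pair u) (filter (Q u) xs))) =
      concat (map (\<lambda>v. if Q u v then [u, v] else []) xs)" for u xs
    by (induction xs) auto
  show "concat (map (\<lambda>u. concat (map (\<lambda>v. if Q u v then [u, v] else []) (rev [0..<u]))) (rev [0..<n])) =
      concat (map (\<lambda>(u, v). [u, v]) (es n))"
  proof (induction n)
    case (Suc n)
    then show ?case unfolding es_Suc map_append concat_append block by simp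
  qed (simp add: es_def)
  have set_es: "set (map (\<lambda>(u, v). {u, v}) (es n)) = {{u, v} | u v. v < u \<and> u < n \<and> Q u v}" for n
    by (fastforce simp: es_def)
  then show "set (map (\<lambda>(u, v). {u, v}) (es n)) = {{u, v} | u v. v < u \<and> u < n \<and> Q u v}" .
  show "distinct (map (\<lambda>(u, v). {u, v}) (es n))"
  proof (induction n)
    case (Suc n)
    have "inj_on (\<lambda>v. {n, v}) {..<n}" by (auto simp: inj_on_def doubleton_eq_iff)
    then have "distinct (map (\<lambda>v. {n, v}) (filter (Q n) (rev [0..<n])))"
      by (auto simp: distinct_map intro: inj_on_subset)
    moreover have "n \<notin> e" if "e \<in> set (map (\<lambda>(u, v). {u, v}) (es n))" for e
      using that unfolding set_es by auto
    ultimately show ?case using Suc unfolding es_Suc by (auto simp: comp_def)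
  qed (simp add: es_def)
qed

lemma solves_compile:
  assumes "machine.runs (word_length \<kappa> n) n G args q (\<lambda>_. 0, []) B (M, ys)" "com_below m q"
    and "R ys" "B \<le> n ^ (C * i)" "real (m * word_length \<kappa> n) \<le> real (C * i) * log 2 (real n)"
  shows "solves \<kappa> C i (compile 0 q) n G args R"
  using assms machine.computes_compile[OF assms(1,2) order_refl] unfolding solves_def by blast

theorem theorem1:
  fixes \<kappa> c :: nat
  assumes "\<kappa> \<ge> 1"
  shows "\<exists>C::nat. \<forall>k\<ge>1. \<forall>P :: nat \<Rightarrow> graph \<Rightarrow> nat \<Rightarrow> bool.
    (\<forall>i\<in>{1..k}. logspace_decidable \<kappa> c P i) \<longrightarrow>
    (\<forall>i\<in>{1..k}. \<exists>enumS memS enumV memV enumE memE.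
       \<forall>n\<ge>2. \<forall>G. simple_graph_on n G \<longrightarrow>
         enumerates_vertices \<kappa> C i enumS n G (deleted P G i) \<and>
         answers_vertex_queries \<kappa> C i memS n G (deleted P G i) \<and>
         enumerates_vertices \<kappa> C i enumV n G (verts (layer P G i)) \<and>
         answers_vertex_queries \<kappa> C i memV n G (verts (layer P G i)) \<and>
         enumerates_edges \<kappa> C i enumE n G (edges (layer P G i)) \<and>
         answers_edge_queries \<kappa> C i memE n G (edges (layer P G i)))"
proof -
  \<comment> \<open>The second summand is for space: \<open>b + 3 \<le> (4 * c + 13) * i\<close>
    cells are used, each of at most \<open>3 * \<kappa> * log 2 n\<close> bits.\<close>
  define C where "C = time_exponent \<kappa> c + 3 * \<kappa> * (4 * c + 13)"
  show ?thesis
  proof (intro exI[of _ C] allI impI ballI)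
    fix k i :: nat and P :: "nat \<Rightarrow> graph \<Rightarrow> nat \<Rightarrow> bool"
    assume dec: "\<forall>i\<in>{1..k}. logspace_decidable \<kappa> c P i" and ik: "i \<in> {1..k}"
    have "\<forall>j\<in>{1..k}. \<exists>p. length p \<le> c \<and> (\<forall>n\<ge>2. \<forall>G. simple_graph_on n G \<longrightarrow>
        (\<forall>v\<in>verts (layer P G (j - 1)). \<exists>t m. computes (word_length \<kappa> n) p n (layer P G (j - 1)) [v]
          [of_bool (P j (layer P G (j - 1)) v)] t m \<and>
          real (m * word_length \<kappa> n) \<le> real c * log 2 (real n)))"
      using dec unfolding logspace_decidable_def .
    \<comment> \<open>One program per round is fixed before \<open>n\<close> and \<open>G\<close>,
      as the constructed programs contain them.\<close>
    from bchoice[OF this] obtain ps where ps: "\<And>j. j \<in> {1..k} \<Longrightarrow> length (ps j) \<le> c"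
      "\<And>j n G v. j \<in> {1..k} \<Longrightarrow> 2 \<le> n \<Longrightarrow> simple_graph_on n G \<Longrightarrow> v \<in> verts (layer P G (j - 1)) \<Longrightarrow>
        \<exists>t m. computes (word_length \<kappa> n) (ps j) n (layer P G (j - 1)) [v]
          [of_bool (P j (layer P G (j - 1)) v)] t m \<and>
          real (m * word_length \<kappa> n) \<le> real c * log 2 (real n)"
      by blast
    have i: "1 \<le> i" and len: "\<forall>j\<in>{1..i}. length (ps j) \<le> c" using ik ps(1) by auto
    define b' b where "b' = base c i" and "b = base c (Suc i)"
    define qV qS where "qV = layer_com c ps i" and "qS = deleted_com c ps i"
    have b: "Suc b' < b" by (simp add: b'_def b_def base_Suc)
    have below: "com_below b qV" "com_below b qS"
      using com_below_layer_com[OF len] com_below_deleted_com[OF len i]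
      by (simp_all add: qV_def qS_def b_def)
    have all: "enumerates_vertices \<kappa> C i (compile 0 (enum_com qS b' b)) n G (deleted P G i) \<and>
        answers_vertex_queries \<kappa> C i (compile 0 (member_com qS b')) n G (deleted P G i) \<and>
        enumerates_vertices \<kappa> C i (compile 0 (enum_com qV b' b)) n G (verts (layer P G i)) \<and>
        answers_vertex_queries \<kappa> C i (compile 0 (member_com qV b')) n G (verts (layer P G i)) \<and>
        enumerates_edges \<kappa> C i (compile 0 (edge_enum_com qV b' b)) n G (edges (layer P G i)) \<and>
        answers_edge_queries \<kappa> C i (compile 0 (edge_member_com qV b' b)) n G (edges (layer P G i))"
      if n: "2 \<le> n" and G: "simple_graph_on n G" for n G
    proof -
      define w where "w = word_length \<kappa> n"
      note wb = word_length_bounds[OF n assms, folded w_def]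
      have log1: "1 \<le> log 2 (real n)" using n by simp
      define B where "B = round_factor c w ^ i"
      have comp: "\<exists>t m. computes w (ps j) n (layer P G (j - 1)) [v]
          [of_bool (P j (layer P G (j - 1)) v)] t m \<and> m \<le> c"
        if jv: "j \<in> {1..i}" "v \<in> verts (layer P G (j - 1))" for j v
      proof -
        obtain t m where tm: "computes w (ps j) n (layer P G (j - 1)) [v]
            [of_bool (P j (layer P G (j - 1)) v)] t m" "real (m * w) \<le> real c * log 2 (real n)"
          using ps(2)[OF _ n G jv(2)] jv(1) ik unfolding w_def by auto
        have "real m * log 2 (real n) \<le> real m * real w" using wb(5) by (rule mult_left_mono) simp
        then have "real m * log 2 (real n) \<le> real c * log 2 (real n)" using tm(2) by simp
        then have "m \<le> c" using log1 by simp
        then show ?thesis using tm(1) by blast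
      qed
      have ans: "machine.answers w n G args qV b' b (verts (layer P G i)) B"
        "machine.answers w n G args qS b' b (deleted P G i) B" for args
        using machine.answers_layer_com[OF G wb(1,2) len comp] i
        by (auto simp: qV_def qS_def b'_def b_def B_def)
      \<comment> \<open>The edge enumeration is the slowest of the four kinds of programs, so its
        bound covers the others.\<close>
      define T where "T = n * (n * (2 * B + 15) + 6) + 2"
      have "T \<le> n ^ (time_exponent \<kappa> c * i)"
        unfolding T_def B_def by (rule total_time[OF n i wb(3)])
      also have "\<dots> \<le> n ^ (C * i)" using n by (intro power_increasing) (auto simp: C_def)
      finally have T: "T \<le> n ^ (C * i)" .
      have "n * (B + 9) \<le> n * (n * (2 * B + 15))"
        using n mult_le_mono[of 1 n "B + 9" "2 * B + 15"] by (intro mult_left_mono) auto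
      moreover have "2 * B + 15 \<le> n * (n * (2 * B + 15))"
        using n mult_le_mono[of 1 "n * n" "2 * B + 15" "2 * B + 15"] by (simp add: mult.assoc)
      ultimately have times: "B + 2 \<le> n ^ (C * i)" "n * (B + 9) + 2 \<le> n ^ (C * i)"
        "2 * B + 10 \<le> n ^ (C * i)" "n * (n * (2 * B + 15) + 6) + 2 \<le> n ^ (C * i)"
        using T unfolding T_def by (auto simp: distrib_left)
      have space: "real ((b + 3) * word_length \<kappa> n) \<le> real (C * i) * log 2 (real n)"
      proof -
        have "b + 3 \<le> (4 * c + 13) * i"
          using i mult_le_mono2[OF i, of "2 * c + 8"] by (simp add: b_def base_def algebra_simps)
        then have "(b + 3) * (3 * \<kappa>) \<le> (4 * c + 13) * i * (3 * \<kappa>)" by (rule mult_right_mono) simp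
        also have "\<dots> \<le> C * i" by (simp add: C_def algebra_simps)
        finally have le: "real ((b + 3) * (3 * \<kappa>)) \<le> real (C * i)" using of_nat_le_iff by blast
        have "real ((b + 3) * w) \<le> real (b + 3) * (real (3 * \<kappa>) * log 2 (real n))"
          unfolding of_nat_mult using wb(4) by (intro mult_left_mono) auto
        also have "\<dots> = real ((b + 3) * (3 * \<kappa>)) * log 2 (real n)" by simp
        also have "\<dots> \<le> real (C * i) * log 2 (real n)"
          using le log1 by (intro mult_right_mono) auto
        finally show ?thesis by (simp add: w_def)
      qed
      note topV = com_below_top[OF below(1) b] and topS = com_below_top[OF below(2) b]
      have VG: "verts G = {..<n}" using G by (simp add: simple_graph_on_def)
      have SV: "deleted P G i \<subseteq> {..<n}" "verts (layer P G i) \<subseteq> {..<n}"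
        using layer_verts_subset[of P G] VG by (auto simp: deleted_def)
      have enum: "enumerates_vertices \<kappa> C i (compile 0 (enum_com q b' b)) n G X"
        if q: "machine.answers w n G [] q b' b X B" "com_below (b + 3) (enum_com q b' b)" "X \<subseteq> {..<n}" for q X
      proof -
        obtain M where "machine.runs w n G [] (enum_com q b' b) (\<lambda>_. 0, []) (n * (B + 9) + 2)
            (M, filter (\<lambda>v. v \<in> X) (rev [0..<n]))"
          using machine.runs_enum_com[OF q(1) wb(1,2)] by blast
        then show ?thesis unfolding enumerates_vertices_def w_def
          by (rule solves_compile[OF _ q(2) _ times(2) space]) (use q(3) in auto)
      qed
      have member: "answers_vertex_queries \<kappa> C i (compile 0 (member_com q b')) n G X"
        if q: "\<And>args. machine.answers w n G args q b' b X B" "com_below (b + 3) (member_com q b')" for q X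
        unfolding answers_vertex_queries_def
      proof
        fix v
        obtain M where "machine.runs w n G [v] (member_com q b') (\<lambda>_. 0, []) (B + 2) (M, [of_bool (v \<in> X)])"
          using machine.runs_member_com[OF q(1)[of "[v]"]] by auto
        then show "solves \<kappa> C i (compile 0 (member_com q b')) n G [v] (\<lambda>ys. ys = [of_bool (v \<in> X)])"
          unfolding w_def by (rule solves_compile[OF _ q(2) _ times(1) space]) simp
      qed
      let ?X = "verts (layer P G i)"
      have edge: "u \<in> ?X \<and> v \<in> ?X \<and> {u, v} \<in> edges G \<longleftrightarrow> {u, v} \<in> edges (layer P G i)" for u v
        using layer_edges[OF G, of P i] by auto
      have edge_member: "answers_edge_queries \<kappa> C i (compile 0 (edge_member_com qV b' b)) n G (edges (layer P G i))"
        unfolding answers_edge_queries_def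
      proof (intro ballI)
        fix u v
        obtain M where "machine.runs w n G [u, v] (edge_member_com qV b' b) (\<lambda>_. 0, []) (2 * B + 10)
            (M, [of_bool ({u, v} \<in> edges (layer P G i))])"
          using machine.runs_edge_member_com[OF ans(1)[of "[u, v]"] refl] unfolding edge by blast
        then show "solves \<kappa> C i (compile 0 (edge_member_com qV b' b)) n G [u, v]
            (\<lambda>ys. ys = [of_bool ({u, v} \<in> edges (layer P G i))])"
          unfolding w_def by (rule solves_compile[OF _ topV(3) _ times(3) space]) simp
      qed
      have edge_enum: "enumerates_edges \<kappa> C i (compile 0 (edge_enum_com qV b' b)) n G (edges (layer P G i))"
      proof -
        let ?Q = "\<lambda>u v. {u, v} \<in> edges (layer P G i)"
        note el = edge_list[where Q = ?Q and n = n]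
        obtain M where "machine.runs w n G [] (edge_enum_com qV b' b) (\<lambda>_. 0, [])
            (n * (n * (2 * B + 15) + 6) + 2)
            (M, concat (map (\<lambda>u. concat (map (\<lambda>v. if ?Q u v then [u, v] else []) (rev [0..<u]))) (rev [0..<n])))"
          using machine.runs_edge_enum_com[OF ans(1)[of "[]"] wb(1,2)] unfolding edge by blast
        moreover have "{{u, v} | u v. v < u \<and> u < n \<and> ?Q u v} = edges (layer P G i)"
        proof (intro equalityI subsetI)
          fix e assume e: "e \<in> edges (layer P G i)"
          then have "e \<subseteq> {..<n}" "card e = 2"
            using layer_edges[OF G, of P i] G SV(2) by (auto simp: simple_graph_on_def)
          then obtain x y where xy: "e = {x, y}" "x \<noteq> y" "x < n" "y < n"
            by (auto simp: card_2_iff)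
          \<comment> \<open>The loops meet an edge with its larger endpoint as the outer
            counter.\<close>
          have "e = {max x y, min x y}" "min x y < max x y" "max x y < n"
            using xy by (auto simp: min_def max_def)
          then show "e \<in> {{u, v} | u v. v < u \<and> u < n \<and> ?Q u v}"
            using e by blast
        qed auto
        ultimately show ?thesis unfolding enumerates_edges_def w_def
          using el by (intro solves_compile[OF _ topV(4) _ times(4) space]) auto
      qed
      show ?thesis
        using enum[OF ans(2) topS(2) SV(1)] member[OF ans(2) topS(1)]
          enum[OF ans(1) topV(2) SV(2)] member[OF ans(1) topV(1)] edge_enum edge_member by blast
    qed
    then show "\<exists>enumS memS enumV memV enumE memE. \<forall>n\<ge>2. \<forall>G. simple_graph_on n G \<longrightarrow>
         enumerates_vertices \<kappa> C i enumS n G (deleted P G i) \<and>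
         answers_vertex_queries \<kappa> C i memS n G (deleted P G i) \<and>
         enumerates_vertices \<kappa> C i enumV n G (verts (layer P G i)) \<and>
         answers_vertex_queries \<kappa> C i memV n G (verts (layer P G i)) \<and>
         enumerates_edges \<kappa> C i enumE n G (edges (layer P G i)) \<and>
         answers_edge_queries \<kappa> C i memE n G (edges (layer P G i))"
      by (intro exI allI impI) (rule all)
  qed
qed

end
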